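(* Let $\{X_n, n\ge1\}$ be independent and identically distributed random variables with values in a countably infinite alphabet $\mathcal{A}=\{a_i: i\ge1\}$ and common nonuniform distribution $\{p_i, i\ge1\}$, $p_i=\mathbb{P}(X_1=a_i)$. Assume that there exist a positive-integer-valued function $K(n)$, a number $0<\delta<\frac12$ and a constant $C_0$ such that $\mathbb{E}|\ln p(X_1)|^{2+\delta}<\infty$ and, for all $n\ge1$, $$K(n)\le n^{\frac12-\delta},\qquad n^{\frac12+\delta}\ln n\sum_{i=K(n)}^\infty p_i\le C_0,\qquad -n^{\frac12+\delta}\sum_{i=K(n)}^\infty p_i\ln p_i\le C_0.$$ Let $H=-\sum_{i=1}^\infty p_i\ln p_i$, let $\sigma^2=\mathrm{Var}(\ln p(X_1))$, $\sigma>0$, and let $\hat H_{MM}$ be the Miller–Madow entropy estimator based on $X_1,\dots,X_n$. Then there is a constant $C>0$, not depending on $n$, such that for every $n\ge1$, $$\sup_{x\in\mathbb{R}}\left|\mathbb{P}\left(\frac{\sqrt n(\hat H_{MM}-H)}{\sigma}<x\right)-\Phi(x)\right|\le C n^{-\frac{\delta}{2}},$$ where $\Phi$ is the standard normal distribution function.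
   Context: $p(X_1)$ denotes the random variable equal to $p_i$ on the event $\{X_1=a_i\}$. Some $p_i$ may be zero; the convention $0\ln 0=0$ is used. "Nonuniform" means that the positive $p_i$ are not all equal, equivalently $\mathrm{Var}(\ln p(X_1))>0$. For each $n$, with $I_A$ the indicator of the event $A$, let $Y_i=\sum_{k=1}^n I_{\{X_k=a_i\}}$ be the letter counts, $\hat p_i=Y_i/n$, and $\hat m=\sum_{i=1}^\infty I_{\{Y_i>0\}}$ the number of distinct letters observed. The plug-in estimator is $\hat H_n=-\sum_{i=1}^\infty\hat p_i\ln\hat p_i$, and the Miller–Madow estimator is $$\hat H_{MM}=\hat H_n+\frac{\hat m-1}{2n}.$$ *)

theory Defs
  imports "HOL-Probability.Probability"
begin

text \<open>
  The alphabet is \<open>a ` {1..}\<close> for an enumeration \<open>a\<close> that is injective on \<open>{1..}\<close>, and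
  the sample is \<open>X 1, X 2, ...\<close>; the values \<open>a 0\<close> and \<open>X 0\<close> are never used.
  The convention \<open>0 * ln 0 = 0\<close> holds because \<open>0 * y = 0\<close> for every real \<open>y\<close>.
\<close>

text \<open>
  With \<open>p i = letter_prob M (X 1) (a i)\<close>, the random variable \<open>p(X\<^sub>1)\<close> is
  \<open>\<lambda>\<omega>. letter_prob M (X 1) (X 1 \<omega>)\<close>: it takes the value \<open>p i\<close> wherever \<open>X 1 \<omega> = a i\<close>.
\<close>

definition letter_prob :: "'w measure \<Rightarrow> ('w \<Rightarrow> 'a) \<Rightarrow> 'a \<Rightarrow> real" where
  "letter_prob M Z x = measure M {\<omega> \<in> space M. Z \<omega> = x}"

definition nonuniform :: "(nat \<Rightarrow> real) \<Rightarrow> bool" where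
  "nonuniform p \<longleftrightarrow> (\<exists>i\<ge>1. \<exists>j\<ge>1. p i > 0 \<and> p j > 0 \<and> p i \<noteq> p j)"

definition shannon_entropy :: "(nat \<Rightarrow> real) \<Rightarrow> real" where
  "shannon_entropy p = - (\<Sum>\<^sub>\<infinity>i\<in>{1..}. p i * ln (p i))"

definition letter_count ::
    "(nat \<Rightarrow> 'a) \<Rightarrow> (nat \<Rightarrow> 'w \<Rightarrow> 'a) \<Rightarrow> nat \<Rightarrow> 'w \<Rightarrow> nat \<Rightarrow> nat" where
  "letter_count a X n \<omega> i = (\<Sum>k=1..n. of_bool (X k \<omega> = a i))"

definition empirical_prob ::
    "(nat \<Rightarrow> 'a) \<Rightarrow> (nat \<Rightarrow> 'w \<Rightarrow> 'a) \<Rightarrow> nat \<Rightarrow> 'w \<Rightarrow> nat \<Rightarrow> real" where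
  "empirical_prob a X n \<omega> i = real (letter_count a X n \<omega> i) / real n"

definition distinct_letters ::
    "(nat \<Rightarrow> 'a) \<Rightarrow> (nat \<Rightarrow> 'w \<Rightarrow> 'a) \<Rightarrow> nat \<Rightarrow> 'w \<Rightarrow> real" where
  "distinct_letters a X n \<omega> = (\<Sum>\<^sub>\<infinity>i\<in>{1..}. of_bool (letter_count a X n \<omega> i > 0))"

definition plugin_entropy ::
    "(nat \<Rightarrow> 'a) \<Rightarrow> (nat \<Rightarrow> 'w \<Rightarrow> 'a) \<Rightarrow> nat \<Rightarrow> 'w \<Rightarrow> real" where
  "plugin_entropy a X n \<omega> = shannon_entropy (empirical_prob a X n \<omega>)"

definition miller_madow ::
    "(nat \<Rightarrow> 'a) \<Rightarrow> (nat \<Rightarrow> 'w \<Rightarrow> 'a) \<Rightarrow> nat \<Rightarrow> 'w \<Rightarrow> real" where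
  "miller_madow a X n \<omega> =
     plugin_entropy a X n \<omega> + (distinct_letters a X n \<omega> - 1) / (2 * real n)"

end

theory Submission imports Defs begin

text \<open>
  Up to an error \<open>R\<close>, the Miller--Madow estimator is the average of the i.i.d. variables
  \<open>- ln p(X\<^sub>k)\<close>, whose mean is \<open>H\<close>. The error is \<open>(m - 1) / (2n)\<close>, with \<open>m\<close> the number of letters
  observed, minus the Kullback--Leibler divergence of the empirical distribution from \<open>p\<close>. The
  divergence is nonnegative, and it is at most the chi-square distance on the letters below
  \<open>K(n)\<close>, of mean at most \<open>K(n) / n\<close>, plus the empirical mean of \<open>- ln p\<close> over the remaining
  letters, whose expectation is the entropy tail. So \<open>\<bar>R\<bar>\<close> has mean \<open>O(n powr (- 1/2 - \<delta>))\<close>, and Markov's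
  inequality at level \<open>n powr (- \<delta> / 2)\<close> bounds its effect on the distribution function.

  The average of the \<open>- ln p(X\<^sub>k)\<close> is covered by the Berry--Esseen theorem under a moment of order
  \<open>2 + \<delta>\<close>, obtained from Esseen's smoothing argument with the Fejer kernel, whose
  characteristic function vanishes outside \<open>[-1, 1]\<close>.
\<close>

subsection \<open>The Fejer kernel\<close>

text \<open>The sums of the \<open>- ln p(X_k)\<close> have a discrete law, so characteristic
  function inversion cannot be applied at arbitrary endpoints. Convolving with the Fejer law scaled
  by \<open>1 / T\<close> removes the atoms. Only \<open>\<bar>t\<bar> \<le> T\<close> then matters,
  and with \<open>T = c * sqrt n\<close> this is exactly the range in which a Taylor estimate at
  \<open>t / sqrt n\<close> is available. There the difference of \<open>n\<close>-th powers costs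
  \<open>n * \<bar>t / sqrt n\<bar> powr (2 + \<delta>)\<close>, which is
  \<open>n powr (- \<delta> / 2)\<close> times a power of \<open>\<bar>t\<bar>\<close>: this is the
  source of the rate. In the remainder, the chi-square distance costs at most \<open>1 / n\<close>
  per letter, however small \<open>p i\<close> is. This forces a cutoff, and beyond
  \<open>K(n)\<close> the logarithm is not linearised at all. After multiplication by
  \<open>sqrt n\<close> the mean remainder is \<open>O(n powr (- \<delta>))\<close>. A Markov level
  \<open>\<epsilon>\<close> costs \<open>\<epsilon>\<close> through the Lipschitz property of the
  normal distribution function and \<open>O(n powr (- \<delta>) / \<epsilon>)\<close> in
  probability; \<open>n powr (- \<delta> / 2)\<close> balances the two.\<close>

lemma has_bochner_integral_one_minus_cos_div_square:
  fixes a :: real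
  shows "has_bochner_integral lborel (\<lambda>x. (1 - cos (a * x)) / x\<^sup>2) (pi * \<bar>a\<bar>)"
proof -
  have pos: "has_bochner_integral lborel (\<lambda>x. (1 - cos (a * x)) / x\<^sup>2) (pi * a)" if a: "a > 0" for a :: real
  proof -
    let ?f = "\<lambda>x. (1 - cos (a * x)) / x\<^sup>2"
    \<comment> \<open>Integration by parts: the boundary term is
      \<open>- (1 - cos (a * x)) / x\<close>, and the remaining integrand
      \<open>a * sin (a * x) / x\<close> has antiderivative \<open>a * Si (a * x)\<close>. The value
      \<open>pi / 2\<close> of \<open>Si\<close> at infinity gives half of the claim on the
      half-line.\<close>
    let ?F = "\<lambda>x. a * Si (a * x) - (1 - cos (a * x)) / x"
    have lim0: "(?F \<longlongrightarrow> 0) (at_right 0)"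
    proof -
      have "((\<lambda>x. 1 - cos (a * x)) has_real_derivative 0) (at 0)"
        by (auto intro!: derivative_eq_intros)
      then have "((\<lambda>x. (1 - cos (a * x)) / x) \<longlongrightarrow> 0) (at 0)"
        by (simp add: has_field_derivative_iff)
      then have 1: "((\<lambda>x. (1 - cos (a * x)) / x) \<longlongrightarrow> 0) (at_right 0)"
        by (rule filterlim_mono) (auto simp: at_le)
      have "isCont (\<lambda>x. a * Si (a * x)) 0"
        by (intro continuous_intros isCont_o2[OF _ isCont_Si])
      then have "((\<lambda>x. a * Si (a * x)) \<longlongrightarrow> a * Si 0) (at_right 0)"
        by (auto simp: isCont_def intro: filterlim_mono at_le)
      moreover have "Si 0 = 0" using Si_neg[of 0] by simp
      ultimately show ?thesis using tendsto_diff[OF _ 1] by fastforce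
    qed
    have liminf: "(?F \<longlongrightarrow> a * (pi / 2)) at_top"
    proof -
      have "filterlim (\<lambda>x. a * x) at_top at_top"
        using a by (intro filterlim_tendsto_pos_mult_at_top[OF tendsto_const] filterlim_ident)
      then have 1: "((\<lambda>x. a * Si (a * x)) \<longlongrightarrow> a * (pi / 2)) at_top"
        by (intro tendsto_intros filterlim_compose[OF Si_at_top])
      have "((\<lambda>x. (1 - cos (a * x)) / x) \<longlongrightarrow> 0) at_top"
      proof (rule Lim_null_comparison)
        show "\<forall>\<^sub>F x in at_top. norm ((1 - cos (a * x)) / x) \<le> 2 / x"
          using eventually_gt_at_top[of 0]
        proof eventually_elim
          case (elim x)
          have "\<bar>1 - cos (a * x)\<bar> \<le> 2" using cos_ge_minus_one[of "a*x"] by (auto simp: abs_le_iff)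
          then show ?case using elim by (simp add: divide_right_mono)
        qed
        show "((\<lambda>x::real. 2 / x) \<longlongrightarrow> 0) at_top"
          by (intro tendsto_divide_0[OF tendsto_const] filterlim_at_top_imp_at_infinity filterlim_ident)
      qed
      from tendsto_diff[OF 1 this] show ?thesis by simp
    qed
    have deriv: "(?F has_real_derivative ?f x) (at x)" if "x > 0" for x
    proof -
      have "((\<lambda>x. Si (a * x)) has_real_derivative sinc (a * x) * a) (at x)"
        by (rule DERIV_chain2[OF DERIV_Si]) (auto intro!: derivative_eq_intros)
      then have "(?F has_real_derivative a * (sinc (a * x) * a) - ((sin (a * x) * a) * x - (1 - cos (a * x))) / x\<^sup>2) (at x)"
        using that by (auto intro!: derivative_eq_intros simp: power2_eq_square)
      moreover have "a * (sinc (a * x) * a) - ((sin (a * x) * a) * x - (1 - cos (a * x))) / x\<^sup>2 = ?f x"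
        using that a by (simp add: field_simps power2_eq_square)
      ultimately show ?thesis by simp
    qed
    have nonneg: "0 \<le> ?f x" for x by simp
    have *: "set_integrable lborel (einterval 0 \<infinity>) ?f" "(LBINT x=0..\<infinity>. ?f x) = a * (pi / 2) - 0"
      by (rule interval_integral_FTC_nonneg[where F = ?F];
          auto simp: zero_ereal_def ereal_tendsto_simps nonneg intro!: deriv lim0[simplified] liminf[simplified] continuous_intros)+
    have "has_bochner_integral lborel (\<lambda>x. indicator {0<..} x *\<^sub>R ?f x) (pi * a / 2)"
      using *(1) *(2)[unfolded interval_lebesgue_integral_0_infty]
      by (simp add: has_bochner_integral_iff set_integrable_def set_lebesgue_integral_def einterval_def greaterThan_def)
    \<comment> \<open>The fundamental theorem delivers the open half-line, the reflection rule for
      even functions wants the closed one; the endpoint is a null set.\<close>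
    moreover have "AE x in lborel. indicator {0<..} x *\<^sub>R ?f x = indicator {0..} x *\<^sub>R ?f x"
      using AE_lborel_singleton[of 0] by eventually_elim (auto simp: indicator_def)
    ultimately have "has_bochner_integral lborel (\<lambda>x. indicator {0..} x *\<^sub>R ?f x) (pi * a / 2)"
      by (subst has_bochner_integral_cong_AE[symmetric]) auto
    from has_bochner_integral_even_function[OF this] show ?thesis by simp
  qed
  consider "a > 0" | "a = 0" | "a < 0" by linarith
  then show ?thesis
  proof cases
    case 1 then show ?thesis using pos by simp
  next
    case 2 then show ?thesis by (simp add: has_bochner_integral_zero)
  next
    case 3 then show ?thesis using pos[of "- a"] by simp
  qed
qed

text \<open>The junk value \<open>0\<close> at the origin (instead of \<open>1 / (2 * pi)\<close>) is irrelevant: it affects a null set.\<close>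

definition fejer_density :: "real \<Rightarrow> real" where
  "fejer_density x = (1 - cos x) / (pi * x\<^sup>2)"

definition fejer_distribution :: "real measure" where
  "fejer_distribution = density lborel fejer_density"

lemma fejer_density_nonneg: "fejer_density x \<ge> 0"
  by (simp add: fejer_density_def)

lemma fejer_density_measurable [measurable]: "fejer_density \<in> borel_measurable borel"
  unfolding fejer_density_def[abs_def] by measurable

lemma fejer_density_has_integral: "has_bochner_integral lborel fejer_density 1"
proof -
  from has_bochner_integral_divide_zero[OF has_bochner_integral_one_minus_cos_div_square[of 1], of pi]
  show ?thesis by (simp add: fejer_density_def[abs_def] mult.commute)
qed

lemma real_distribution_fejer: "real_distribution fejer_distribution"
proof -
  have "(\<integral>\<^sup>+x. fejer_density x \<partial>lborel) = ennreal (LBINT x. fejer_density x)"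
    using fejer_density_has_integral fejer_density_nonneg
    by (intro nn_integral_eq_integral) (auto simp: has_bochner_integral_iff)
  then have "(\<integral>\<^sup>+x. fejer_density x \<partial>lborel) = 1"
    using fejer_density_has_integral by (simp add: has_bochner_integral_iff)
  then have "prob_space fejer_distribution"
    unfolding fejer_distribution_def by (intro prob_spaceI) (simp add: emeasure_density)
  then show ?thesis
    by (simp add: real_distribution_def real_distribution_axioms_def fejer_distribution_def)
qed

text \<open>By the product formula for cosines, \<open>(1 - cos x) * cos (t * x)\<close> is a
  combination of the integrands \<open>1 - cos (b * x)\<close> with
  \<open>b = t + 1, t - 1, t\<close>. The real part is therefore
  \<open>(\<bar>t + 1\<bar> + \<bar>t - 1\<bar>) / 2 - \<bar>t\<bar>\<close>, the triangle function
  supported on \<open>[-1, 1]\<close>. The imaginary part has an odd integrand.\<close>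

lemma char_fejer:
  assumes "\<bar>t\<bar> \<ge> 1"
  shows "char fejer_distribution t = 0"
proof -
  interpret real_distribution fejer_distribution by (rule real_distribution_fejer)
  have int: "integrable lborel (\<lambda>x. fejer_density x *\<^sub>R iexp (t * x))"
  proof -
    have "integrable fejer_distribution (\<lambda>x. iexp (t * x))"
      by (intro integrable_const_bound[of _ 1]) auto
    then show ?thesis
      unfolding fejer_distribution_def by (subst (asm) integrable_density) (auto simp: fejer_density_nonneg)
  qed
  have eq: "char fejer_distribution t = (CLINT x|lborel. fejer_density x *\<^sub>R iexp (t * x))"
    unfolding char_def fejer_distribution_def
    by (subst integral_density) (auto simp: fejer_density_nonneg)
  let ?g = "\<lambda>b x. (1 - cos (b * x)) / x\<^sup>2 :: real"
  have 1: "has_bochner_integral lborel (\<lambda>x. (?g (t+1) x / 2 + ?g (t-1) x / 2 - ?g t x) / pi)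
     ((pi * \<bar>t+1\<bar> / 2 + pi * \<bar>t-1\<bar> / 2 - pi * \<bar>t\<bar>) / pi)"
    by (intro has_bochner_integral_divide_zero has_bochner_integral_diff has_bochner_integral_add
      has_bochner_integral_one_minus_cos_div_square)
  have 2: "(?g (t+1) x / 2 + ?g (t-1) x / 2 - ?g t x) / pi = fejer_density x * cos (t * x)" for x
    by (cases "x = 0") (auto simp: fejer_density_def cos_add cos_diff field_simps)
  have 3: "(pi * \<bar>t+1\<bar> / 2 + pi * \<bar>t-1\<bar> / 2 - pi * \<bar>t\<bar>) / pi = 0"
  proof -
    have "\<bar>t+1\<bar> / 2 + \<bar>t-1\<bar> / 2 - \<bar>t\<bar> = 0" using assms by (auto simp: abs_if field_simps split: if_splits)
    then have "pi * (\<bar>t+1\<bar> / 2 + \<bar>t-1\<bar> / 2 - \<bar>t\<bar>) / pi = 0" by simp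
    then show ?thesis by (simp add: algebra_simps)
  qed
  have "Re (CLINT x|lborel. fejer_density x *\<^sub>R iexp (t * x)) = (LBINT x. fejer_density x * cos (t * x))"
    by (subst integral_Re[OF int, symmetric]) (simp add: Re_exp)
  also have "\<dots> = 0" using 1 unfolding 2 3 by (simp add: has_bochner_integral_iff)
  finally have re: "Re (char fejer_distribution t) = 0" using eq by simp
  have "(LBINT x. fejer_density x * sin (t * x)) = (LBINT x. - (fejer_density x * sin (t * x)))"
    by (subst lborel_integral_real_affine[where c="-1" and t=0]) (auto simp: fejer_density_def)
  then have "(LBINT x. fejer_density x * sin (t * x)) = 0" by simp
  then have "Im (CLINT x|lborel. fejer_density x *\<^sub>R iexp (t * x)) = 0"
    by (subst integral_Im[OF int, symmetric]) (simp add: Im_exp)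
  then show ?thesis using re eq by (simp add: complex_eq_iff)
qed

lemma measure_fejer_singleton: "measure fejer_distribution {x} = 0"
proof -
  have "emeasure fejer_distribution {x} = (\<integral>\<^sup>+y. ennreal (fejer_density x) * indicator {x} y \<partial>lborel)"
    unfolding fejer_distribution_def by (subst emeasure_density) (auto intro!: nn_integral_cong split: split_indicator)
  also have "\<dots> = 0" by (subst nn_integral_cmult) auto
  finally show ?thesis by (simp add: measure_def)
qed

subsection \<open>Esseen smoothing\<close>

lemma char_convolution:
  assumes "real_distribution M" "real_distribution N"
  shows "char (M \<star> N) t = char M t * char N t"
proof -
  interpret M: real_distribution M by fact
  interpret N: real_distribution N by fact
  interpret pair_prob_space M N ..
  have "char (M \<star> N) t = (CLINT z|M \<Otimes>\<^sub>M N. iexp (t * (fst z + snd z)))"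
    unfolding char_def convolution_def by (subst integral_distr) (auto simp: case_prod_beta)
  also have "\<dots> = (CLINT x|M. CLINT y|N. iexp (t * (x + y)))"
    by (subst integral_fst'[symmetric]) (auto intro!: P.integrable_const_bound[of _ 1])
  also have "\<dots> = (CLINT x|M. iexp (t * x) * char N t)"
    unfolding char_def by (simp add: distrib_left exp_add)
  also have "\<dots> = char M t * char N t" by (simp add: char_def)
  finally show ?thesis .
qed

lemma real_distribution_convolution:
  assumes "real_distribution M" "real_distribution N"
  shows "real_distribution (M \<star> N)"
proof -
  interpret M: real_distribution M by fact
  interpret N: real_distribution N by fact
  interpret pair_prob_space M N ..
  show ?thesis unfolding convolution_def
    by (rule P.real_distribution_distr) measurable
qed

lemma integrable_cdf_diff:
  assumes "real_distribution M" "real_distribution N"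
  shows "integrable M (\<lambda>x. cdf N (t - x))"
proof -
  interpret M: real_distribution M by fact
  interpret N: real_distribution N by fact
  have "mono (cdf N)" by (intro monoI N.cdf_nondecreasing)
  then have [measurable]: "cdf N \<in> borel_measurable borel" by (rule borel_measurable_mono)
  show ?thesis
    by (intro M.integrable_const_bound[of _ 1]) (auto simp: N.cdf_nonneg N.cdf_bounded_prob)
qed

lemma cdf_convolution:
  assumes "real_distribution M" "real_distribution N"
  shows "cdf (M \<star> N) t = (LINT x|M. cdf N (t - x))"
proof -
  interpret M: real_distribution M by fact
  interpret N: real_distribution N by fact
  interpret C: real_distribution "M \<star> N" by (rule real_distribution_convolution; fact)
  have "emeasure (M \<star> N) {..t} = (\<integral>\<^sup>+x. emeasure N {a. a + x \<in> {..t}} \<partial>M)"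
    by (rule convolution_emeasure) (auto intro: M.finite_measure_axioms N.finite_measure_axioms)
  also have "\<dots> = (\<integral>\<^sup>+x. ennreal (cdf N (t - x)) \<partial>M)"
    by (intro nn_integral_cong) (auto simp: cdf_def N.emeasure_eq_measure algebra_simps intro!: arg_cong[where f = "measure N"])
  also have "\<dots> = ennreal (LINT x|M. cdf N (t - x))"
    by (intro nn_integral_eq_integral integrable_cdf_diff assms) (auto simp: N.cdf_nonneg)
  finally show ?thesis
    by (simp add: cdf_def C.emeasure_eq_measure integral_nonneg_AE)
qed

text \<open>Smoothing by an atomless law makes every point a continuity point, as the inversion
  formula requires of its endpoints.\<close>

lemma convolution_singleton:
  assumes "real_distribution M" "real_distribution N" "\<And>x. measure M {x} = 0"
  shows "measure (M \<star> N) {x} = 0"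
proof -
  interpret M: real_distribution M by fact
  interpret N: real_distribution N by fact
  have "emeasure (M \<star> N) {x} = emeasure (N \<star> M) {x}"
    by (subst convolution_commutative) (auto intro: M.finite_measure_axioms N.finite_measure_axioms)
  also have "\<dots> = (\<integral>\<^sup>+y. emeasure M {a. a + y \<in> {x}} \<partial>N)"
    by (rule convolution_emeasure) (auto intro: M.finite_measure_axioms N.finite_measure_axioms)
  also have "\<dots> = (\<integral>\<^sup>+y. 0 \<partial>N)"
  proof (intro nn_integral_cong)
    fix y
    have "{a. a + y \<in> {x}} = {x - y}" by auto
    then show "emeasure M {a. a + y \<in> {x}} = 0" using assms(3) by (simp add: M.emeasure_eq_measure)
  qed
  finally show ?thesis by (simp add: measure_def)
qed

text \<open>Subtract the two Levy inversion formulas. The inversion kernel is at most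
  \<open>2 / \<bar>t\<bar>\<close>, which the factor \<open>\<bar>t\<bar>\<close> in the hypothesis
  cancels, and the prefactor \<open>1 / (2 * pi)\<close> turns \<open>2 * g\<close> into
  \<open>g / pi\<close>.\<close>

lemma cdf_diff_le_char_diff:
  assumes P: "real_distribution P" and Q: "real_distribution Q"
    and atoms: "\<And>x. measure P {x} = 0" "\<And>x. measure Q {x} = 0"
    and g: "integrable lborel g" and le: "\<And>t. cmod (char P t - char Q t) \<le> \<bar>t\<bar> * g t"
    and g0: "\<And>t. g t \<ge> 0"
  shows "\<bar>cdf P x - cdf Q x\<bar> \<le> (LINT t|lborel. g t) / pi"
proof -
  interpret P: real_distribution P by fact
  interpret Q: real_distribution Q by fact
  have interval: "\<bar>measure P {a<..b} - measure Q {a<..b}\<bar> \<le> (LINT t|lborel. g t) / pi" if ab: "a \<le> b" for a b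
  proof -
    define G where "G t = (iexp (-(t * a)) - iexp (-(t * b))) / (\<i> * t)" for t :: real
    \<comment> \<open>Two bounds with different roles: \<open>G1\<close> is finite near the origin
      and gives integrability on each truncated range; \<open>G2\<close> does not depend on
      \<open>a\<close> and \<open>b\<close> and gives the estimate.\<close>
    have G1: "cmod (G t) \<le> b - a" if "t \<noteq> 0" for t
      using Levy_Inversion_aux2[of "-b" "-a" t] ab that by (simp add: G_def)
    have G2: "cmod (G t) * \<bar>t\<bar> \<le> 2" for t
    proof (cases "t = 0")
      case False
      have "cmod (G t) * \<bar>t\<bar> = cmod (iexp (-(t * a)) - iexp (-(t * b)))"
        using False by (simp add: G_def norm_divide norm_mult)
      also have "\<dots> \<le> cmod (iexp (-(t * a))) + cmod (iexp (-(t * b)))" by (rule norm_triangle_ineq4)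
      also have "\<dots> = 2" by (simp only: norm_exp_i_times)
      finally show ?thesis .
    qed simp
    have [measurable]: "G \<in> borel_measurable borel" unfolding G_def[abs_def] by measurable
    have int: "set_integrable lborel {-real n<..<real n} (\<lambda>t. G t * char M t)" if M: "real_distribution M" for M n
    proof -
      interpret M: real_distribution M by fact
      show ?thesis unfolding set_integrable_def
      proof (intro integrableI_bounded_set_indicator[where B="b - a"])
        show "AE t in lborel. t \<in> {- real n<..<real n} \<longrightarrow> cmod (G t * char M t) \<le> b - a"
          using AE_lborel_singleton[of 0]
        proof eventually_elim
          case (elim t)
          then show ?case using mult_mono[OF G1[of t] M.cmod_char_le_1[of t]] ab by (simp add: norm_mult)
        qed
      qed auto
    qed
    define L where "L M n = 1 / (2 * pi) * (CLBINT t=-real n..real n. G t * char M t)" for M n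
    have lim: "(\<lambda>n. L P n - L Q n) \<longlonglongrightarrow> of_real (measure P {a<..b}) - of_real (measure Q {a<..b})"
      using P.Levy_Inversion[OF ab atoms(1) atoms(1)] Q.Levy_Inversion[OF ab atoms(2) atoms(2)]
      by (intro tendsto_diff) (simp_all add: L_def G_def)
    have bound: "cmod (L P n - L Q n) \<le> (LINT t|lborel. g t) / pi" for n
    proof -
      let ?I = "{-real n<..<real n}"
      have L: "L M n = 1 / (2 * pi) * (CLINT t|lborel. indicator ?I t *\<^sub>R (G t * char M t))" for M
        by (simp add: L_def interval_lebesgue_integral_def set_lebesgue_integral_def)
      have "L P n - L Q n = 1 / (2 * pi) * (CLINT t|lborel. indicator ?I t *\<^sub>R (G t * char P t) - indicator ?I t *\<^sub>R (G t * char Q t))"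
        using int[OF P] int[OF Q] unfolding L set_integrable_def by (simp add: right_diff_distrib)
      also have "cmod \<dots> \<le> 1 / (2 * pi) * (LINT t|lborel. 2 * g t)"
      proof -
        have "cmod (CLINT t|lborel. indicator ?I t *\<^sub>R (G t * char P t) - indicator ?I t *\<^sub>R (G t * char Q t)) \<le> (LINT t|lborel. 2 * g t)"
        proof (rule Bochner_Integration.integral_norm_bound_integral)
          fix t
          have "cmod (indicator ?I t *\<^sub>R (G t * char P t) - indicator ?I t *\<^sub>R (G t * char Q t))
              = indicator ?I t * (cmod (G t) * cmod (char P t - char Q t))"
            by (simp add: norm_mult[symmetric] right_diff_distrib indicator_def)
          also have "\<dots> \<le> 1 * (cmod (G t) * (\<bar>t\<bar> * g t))"
            by (intro mult_mono le) (auto simp: g0 split: split_indicator)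
          also have "\<dots> \<le> 2 * g t" using mult_right_mono[OF G2[of t] g0[of t]] by (simp add: mult.assoc)
          finally show "cmod (indicator ?I t *\<^sub>R (G t * char P t) - indicator ?I t *\<^sub>R (G t * char Q t)) \<le> 2 * g t" .
        next
          show "complex_integrable lborel (\<lambda>t. indicator ?I t *\<^sub>R (G t * char P t) - indicator ?I t *\<^sub>R (G t * char Q t))"
            using int[OF P] int[OF Q] unfolding set_integrable_def by (intro Bochner_Integration.integrable_diff)
        qed (use g in simp)
        from divide_right_mono[OF this, of "2 * pi"] show ?thesis by (simp add: norm_mult norm_divide)
      qed
      also have "\<dots> = (LINT t|lborel. g t) / pi" by simp
      finally show ?thesis .
    qed
    have "cmod (of_real (measure P {a<..b}) - of_real (measure Q {a<..b})) \<le> (LINT t|lborel. g t) / pi"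
      by (rule Lim_bounded[OF tendsto_norm[OF lim], of 0]) (use bound in auto)
    then show ?thesis by (metis norm_of_real of_real_diff)
  qed
  \<comment> \<open>The bound for intervals is uniform in the left endpoint, which may therefore
    tend to minus infinity.\<close>
  have "(\<lambda>n. \<bar>(cdf P x - cdf P (- real n)) - (cdf Q x - cdf Q (- real n))\<bar>) \<longlonglongrightarrow> \<bar>(cdf P x - 0) - (cdf Q x - 0)\<bar>"
    by (intro tendsto_intros P.cdf_lim_neg_infty Q.cdf_lim_neg_infty)
  moreover have "\<bar>(cdf P x - cdf P (- real n)) - (cdf Q x - cdf Q (- real n))\<bar> \<le> (LINT t|lborel. g t) / pi"
    if "n \<ge> nat \<lceil>\<bar>x\<bar>\<rceil> + 1" for n
  proof -
    have "- real n < x" using that by linarith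
    then show ?thesis using interval[of "- real n" x] by (simp add: P.cdf_diff_eq Q.cdf_diff_eq)
  qed
  ultimately show ?thesis by (intro Lim_bounded[of _ _ "nat \<lceil>\<bar>x\<bar>\<rceil> + 1"]) auto
qed

text \<open>
  Since \<open>cdf P\<close> is monotone and \<open>cdf Q\<close> is Lipschitz, a large difference at \<open>x\<close> persists on an interval
  of length \<open>2 * h\<close> to one side of \<open>x\<close>, so smoothing about the midpoint of that interval sees it with weight
  at least \<open>5 / 6\<close>.
\<close>

lemma cdf_diff_le_smoothed:
  assumes P: "real_distribution P" and Q: "real_distribution Q" and W: "real_distribution W"
    and lip: "\<And>x y. x \<le> y \<Longrightarrow> cdf Q y - cdf Q x \<le> m * (y - x)"
    and h: "measure W {-h..h} \<ge> 5 / 6" "h \<ge> 0"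
    and eps: "\<And>x. \<bar>cdf (W \<star> P) x - cdf (W \<star> Q) x\<bar> \<le> \<epsilon>"
  shows "\<bar>cdf P x - cdf Q x\<bar> \<le> 3 / 2 * (\<epsilon> + 2 * m * h)"
proof -
  interpret P: real_distribution P by fact
  interpret Q: real_distribution Q by fact
  interpret W: real_distribution W by fact
  define D where "D x = cdf P x - cdf Q x" for x
  have D1: "\<bar>D x\<bar> \<le> 1" for x unfolding D_def
    using P.cdf_nonneg[of x] Q.cdf_nonneg[of x] P.cdf_bounded_prob[of x] Q.cdf_bounded_prob[of x] by linarith
  have bdd: "bdd_above (range (\<lambda>x. \<bar>D x\<bar>))" using D1 by (intro bdd_aboveI2)
  define \<eta> where "\<eta> = (SUP x. \<bar>D x\<bar>)"
  have eta: "\<bar>D x\<bar> \<le> \<eta>" for x unfolding \<eta>_def by (rule cSUP_upper[OF _ bdd]) simp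
  have Dstep: "D y \<ge> D x - m * (y - x)" if "x \<le> y" for x y
    using lip[OF that] P.cdf_nondecreasing[OF that] by (simp add: D_def)
  have m: "m \<ge> 0" using lip[of 0 1] Q.cdf_nondecreasing[of 0 1] by simp
  have Dint: "integrable W (\<lambda>y. D (x - y))" for x
    unfolding D_def by (intro Bochner_Integration.integrable_diff integrable_cdf_diff assms)
  have Deps: "\<bar>LINT y|W. D (x - y)\<bar> \<le> \<epsilon>" for x
    using eps[of x] unfolding D_def
    by (simp add: cdf_convolution P Q W integrable_cdf_diff)
  define q where "q = measure W {-h..h}"
  have q: "5 / 6 \<le> q" "q \<le> 1" using h W.prob_le_1 by (auto simp: q_def)
  \<comment> \<open>The comparison function is \<open>s\<close> on the window and the worst possible
    value \<open>- \<eta>\<close> off it.\<close>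
  have lower: "(LINT y|W. s * indicator {-h..h} y - \<eta> * (1 - indicator {-h..h} y)) = s * q - \<eta> * (1 - q)" for s
  proof -
    have "(LINT y|W. s * indicator {-h..h} y - \<eta> * (1 - indicator {-h..h} y))
        = (LINT y|W. (s + \<eta>) * indicator {-h..h} y - \<eta>)"
      by (intro Bochner_Integration.integral_cong) (auto simp: algebra_simps)
    also have "\<dots> = (s + \<eta>) * q - \<eta>"
      using W.prob_space by (subst Bochner_Integration.integral_diff) (auto simp: q_def W.emeasure_eq_measure)
    finally show ?thesis by (simp add: algebra_simps)
  qed
  have lowint: "integrable W (\<lambda>y. s * indicator {-h..h} y - \<eta> * (1 - indicator {-h..h} y))" for s
    by (intro Bochner_Integration.integrable_diff integrable_mult_right) (auto simp: W.emeasure_eq_measure)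
  \<comment> \<open>The window must outweigh its complement, so any mass above \<open>1 / 2\<close>
    would close the argument. Mass \<open>5 / 6\<close> leaves a net weight
    \<open>5 / 6 - 1 / 6 = 2 / 3\<close>, whence the final factor \<open>3 / 2\<close>.\<close>
  have arith: "5 / 6 * s \<le> \<epsilon> + 2 * m * h + \<eta> / 6" if "(s - 2 * m * h) * q - \<eta> * (1 - q) \<le> \<epsilon>" "s \<ge> 0" for s
  proof -
    have "s * (5/6) \<le> s * q" using q that by (intro mult_left_mono) auto
    moreover have "(2 * m * h) * q \<le> (2 * m * h) * 1" using q m h by (intro mult_left_mono) auto
    moreover have "\<eta> * (1 - q) \<le> \<eta> * (1 / 6)" using q eta[of 0] by (intro mult_left_mono) auto
    ultimately show ?thesis using that(1) by (simp add: algebra_simps)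
  qed
  have main: "5 / 6 * \<bar>D x\<bar> \<le> \<epsilon> + 2 * m * h + \<eta> / 6" for x
  proof (cases "D x \<ge> 0")
    case True
    have "(LINT y|W. (D x - 2 * m * h) * indicator {-h..h} y - \<eta> * (1 - indicator {-h..h} y)) \<le> (LINT y|W. D (x + h - y))"
    proof (rule integral_mono[OF lowint Dint])
      fix y
      show "(D x - 2 * m * h) * indicator {-h..h} y - \<eta> * (1 - indicator {-h..h} y) \<le> D (x + h - y)"
      proof (cases "y \<in> {-h..h}")
        case True
        have "m * (h - y) \<le> m * (2 * h)" using True m by (intro mult_left_mono) auto
        then show ?thesis using True Dstep[of x "x + h - y"] by (simp add: algebra_simps)
      qed (use eta[of "x + h - y"] in simp)
    qed
    then show ?thesis using Deps[of "x + h"] True by (intro arith) (auto simp: lower)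
  next
    case False
    have "(LINT y|W. (- D x - 2 * m * h) * indicator {-h..h} y - \<eta> * (1 - indicator {-h..h} y)) \<le> (LINT y|W. - D (x - h - y))"
    proof (rule integral_mono[OF lowint integrable_minus[OF Dint]])
      fix y
      show "(- D x - 2 * m * h) * indicator {-h..h} y - \<eta> * (1 - indicator {-h..h} y) \<le> - D (x - h - y)"
      proof (cases "y \<in> {-h..h}")
        case True
        have "m * (h + y) \<le> m * (2 * h)" using True m by (intro mult_left_mono) auto
        then show ?thesis using True Dstep[of "x - h - y" x] by (simp add: algebra_simps)
      qed (use eta[of "x - h - y"] in simp)
    qed
    then show ?thesis using Deps[of "x - h"] False by (intro arith) (auto simp: lower)
  qed
  \<comment> \<open>The bound holds at every \<open>x\<close>, so it passes to the supremum
    \<open>\<eta>\<close>. Since \<open>\<eta>\<close> is finite and returns with coefficient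
    \<open>1 / 5\<close>, it can be absorbed on the left.\<close>
  have "\<bar>D x\<bar> \<le> 6 / 5 * (\<epsilon> + 2 * m * h + \<eta> / 6)" for x
    using mult_left_mono[OF main[of x], of "6 / 5"] by simp
  then have "\<eta> \<le> 6 / 5 * (\<epsilon> + 2 * m * h + \<eta> / 6)" unfolding \<eta>_def by (intro cSUP_least) auto
  then have "\<eta> \<le> 3 / 2 * (\<epsilon> + 2 * m * h)" by (simp add: field_simps)
  then show ?thesis using eta[of x] by (simp add: D_def)
qed

text \<open>The constant is obtained before \<open>P\<close>, \<open>Q\<close>, \<open>T\<close> and
  \<open>g\<close> are chosen: it depends only on how concentrated the Fejer law is, so one constant
  serves all \<open>n\<close>.\<close>

lemma esseen_smoothing:
  obtains C where "C > 0"
    and "\<And>P Q m T g x. real_distribution P \<Longrightarrow> real_distribution Q \<Longrightarrow> T > 0 \<Longrightarrow>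
      (\<And>x y. x \<le> y \<Longrightarrow> cdf Q y - cdf Q x \<le> m * (y - x)) \<Longrightarrow>
      integrable lborel g \<Longrightarrow> (\<And>t. g t \<ge> 0) \<Longrightarrow>
      (\<And>t. \<bar>t\<bar> \<le> T \<Longrightarrow> cmod (char P t - char Q t) \<le> \<bar>t\<bar> * g t) \<Longrightarrow>
      \<bar>cdf P x - cdf Q x\<bar> \<le> C * ((LINT t|lborel. g t) + m / T)"
proof -
  interpret V: real_distribution fejer_distribution by (rule real_distribution_fejer)
  obtain a where a: "a \<ge> 0" "measure fejer_distribution {-a..a} \<ge> 5 / 6"
  proof -
    have "(\<lambda>n. V.prob {- real n..real n}) \<longlonglongrightarrow> V.prob (\<Union>n. {- real n..real n})"
      by (rule V.finite_Lim_measure_incseq) (auto simp: incseq_def)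
    also have "(\<Union>n. {- real n..real n}) = UNIV"
      by (auto, metis abs_le_iff minus_le_iff real_arch_simple)
    also have "V.prob UNIV = 1" using V.prob_space by simp
    finally have "\<forall>\<^sub>F n in sequentially. V.prob {- real n..real n} > 5 / 6"
      by (rule order_tendstoD) simp
    then obtain n where "V.prob {- real n..real n} > 5 / 6"
      by (auto simp: eventually_sequentially)
    then show ?thesis by (intro that[of "real n"]) auto
  qed
  show ?thesis
  \<comment> \<open>The factor \<open>3 / 2\<close> comes from \<open>cdf_diff_le_smoothed\<close>;
    \<open>1 + 2 * a\<close> dominates both \<open>1 / pi\<close>, the weight of the integral, and
    \<open>2 * a\<close>, the weight of \<open>m / T\<close>.\<close>
  proof (rule that[of "3 / 2 * (1 + 2 * a)"])
    fix P Q :: "real measure" and m T x :: real and g :: "real \<Rightarrow> real"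
    assume P: "real_distribution P" and Q: "real_distribution Q" and T: "T > 0"
      and lip: "\<And>x y. x \<le> y \<Longrightarrow> cdf Q y - cdf Q x \<le> m * (y - x)"
      and g: "integrable lborel g" "\<And>t. g t \<ge> 0"
      and le: "\<And>t. \<bar>t\<bar> \<le> T \<Longrightarrow> cmod (char P t - char Q t) \<le> \<bar>t\<bar> * g t"
    \<comment> \<open>Dividing by \<open>T\<close> stretches the support of the characteristic
      function to \<open>[-T, T]\<close> and shrinks the window to \<open>a / T\<close>. Beyond
      \<open>T\<close> both smoothed characteristic functions vanish, so \<open>le\<close> is only
      needed up to \<open>T\<close>.\<close>
    define W where "W = distr fejer_distribution borel (\<lambda>y. y / T)"
    interpret W: real_distribution W unfolding W_def by (rule V.real_distribution_distr) simp
    interpret Q: real_distribution Q by fact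
    note W = W.real_distribution_axioms
    have charW: "char W t = 0" if "\<bar>t\<bar> > T" for t
    proof -
      have "char W t = char fejer_distribution (t / T)"
        unfolding W_def char_def by (subst integral_distr) auto
      then show ?thesis using that T by (simp add: char_fejer)
    qed
    have atomW: "measure W {x} = 0" for x
    proof -
      have "(\<lambda>y. y / T) -` {x} = {x * T}" using T by (auto simp: field_simps)
      then show ?thesis unfolding W_def by (subst measure_distr) (auto simp: measure_fejer_singleton)
    qed
    have hW: "measure W {-(a / T)..a / T} \<ge> 5 / 6"
    proof -
      have "(\<lambda>y. y / T) -` {-(a / T)..a / T} = {-a..a}" using T by (auto simp: field_simps)
      then show ?thesis using a(2) unfolding W_def by (subst measure_distr) auto
    qed
    have "\<bar>cdf (W \<star> P) x - cdf (W \<star> Q) x\<bar> \<le> (LINT t|lborel. g t) / pi" for x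
    proof (rule cdf_diff_le_char_diff[OF _ _ _ _ g(1) _ g(2)])
      show "real_distribution (W \<star> P)" "real_distribution (W \<star> Q)"
        by (intro real_distribution_convolution P Q W)+
      show "measure (W \<star> P) {x} = 0" "measure (W \<star> Q) {x} = 0" for x
        by (intro convolution_singleton P Q W atomW)+
      show "cmod (char (W \<star> P) t - char (W \<star> Q) t) \<le> \<bar>t\<bar> * g t" for t
      proof (cases "\<bar>t\<bar> \<le> T")
        case True
        have "cmod (char (W \<star> P) t - char (W \<star> Q) t) = cmod (char W t) * cmod (char P t - char Q t)"
          by (simp add: char_convolution P Q W right_diff_distrib[symmetric] norm_mult)
        also have "\<dots> \<le> 1 * (\<bar>t\<bar> * g t)" by (intro mult_mono W.cmod_char_le_1 le True) auto
        finally show ?thesis by simp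
      next
        case False
        then show ?thesis using charW[of t] by (simp add: char_convolution P Q W g)
      qed
    qed
    then have 1: "\<bar>cdf P x - cdf Q x\<bar> \<le> 3 / 2 * ((LINT t|lborel. g t) / pi + 2 * m * (a / T))"
      using a T by (intro cdf_diff_le_smoothed[OF P Q W lip hW]) auto
    have m: "m \<ge> 0" using lip[of 0 1] Q.cdf_nondecreasing[of 0 1] by simp
    have I: "(LINT t|lborel. g t) \<ge> 0" using g by simp
    have "(LINT t|lborel. g t) / pi \<le> (LINT t|lborel. g t) / 1"
      using pi_ge_two I by (intro divide_left_mono) auto
    also have "\<dots> \<le> (1 + 2 * a) * (LINT t|lborel. g t)" using I a by (simp add: algebra_simps)
    moreover have "2 * m * (a / T) \<le> (1 + 2 * a) * (m / T)" using m T by (simp add: field_simps)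
    ultimately have "(LINT t|lborel. g t) / pi + 2 * m * (a / T) \<le> (1 + 2 * a) * ((LINT t|lborel. g t) + m / T)"
      by (simp only: distrib_left)
    from order_trans[OF 1 mult_left_mono[OF this, of "3 / 2"]] show "\<bar>cdf P x - cdf Q x\<bar> \<le> 3 / 2 * (1 + 2 * a) * ((LINT t|lborel. g t) + m / T)"
      by (simp only: mult.assoc)
  qed (use a in simp)
qed

subsection \<open>The Berry--Esseen theorem with a moment of order 2 + delta\<close>

text \<open>Rescaling by \<open>r\<close> reduces to the unit disc. Keeping
  \<open>r ^ (n - 1)\<close> is essential: with \<open>r = exp (- (u\<^sup>2 / 4))\<close> it
  supplies the Gaussian decay that makes the smoothing integral converge uniformly in
  \<open>n\<close>.\<close>

lemma norm_power_diff_le: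
  fixes z w :: complex
  assumes "norm z \<le> r" "norm w \<le> r" "r > 0"
  shows "norm (z ^ n - w ^ n) \<le> n * r ^ (n - 1) * norm (z - w)"
proof (cases n)
  case (Suc m)
  have "norm (z ^ n - w ^ n) = r ^ n * norm ((z / r) ^ n - (w / r) ^ n)"
    using assms by (simp add: power_divide diff_divide_distrib[symmetric] norm_divide norm_power)
  also have "\<dots> \<le> r ^ n * (n * norm (z / r - w / r))"
    using assms by (intro mult_left_mono norm_power_diff) (auto simp: norm_divide)
  also have "\<dots> = n * r ^ (n - 1) * norm (z - w)"
    using assms Suc by (simp add: diff_divide_distrib[symmetric] norm_divide)
  finally show ?thesis .
qed simp

text \<open>Since \<open>1 + y + y\<^sup>2 / 2\<close> is at most \<open>exp y\<close> and its
  product with \<open>1 - y + y\<^sup>2 / 2\<close> is \<open>1 + y ^ 4 / 4\<close>, the second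
  factor is at least \<open>exp (- y)\<close>.\<close>

lemma exp_minus_le_quadratic:
  fixes y :: real
  assumes "y \<ge> 0"
  shows "exp (- y) \<le> 1 - y + y\<^sup>2 / 2"
proof -
  have "(1 + y + y\<^sup>2 / 2) * (1 - y + y\<^sup>2 / 2) = 1 + y ^ 4 / 4"
    by (simp add: algebra_simps power2_eq_square power4_eq_xxxx)
  then have "1 \<le> (1 + y + y\<^sup>2 / 2) * (1 - y + y\<^sup>2 / 2)" by simp
  also have "\<dots> \<le> exp y * (1 - y + y\<^sup>2 / 2)"
  proof (rule mult_right_mono)
    show "1 + y + y\<^sup>2 / 2 \<le> exp y" using assms by (rule exp_lower_Taylor_quadratic)
    have "0 \<le> (y - 1)\<^sup>2" by simp
    then have "0 \<le> 1 - 2 * y + y\<^sup>2" by (simp add: power2_diff)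
    then show "0 \<le> 1 - y + y\<^sup>2 / 2" by simp
  qed
  finally show ?thesis by (simp add: exp_minus field_simps)
qed

text \<open>The third-order Taylor remainder contains \<open>x\<^sup>2 * min 6 y\<close> with
  \<open>y = \<bar>t\<bar> * \<bar>x\<bar>\<close>. Because
  \<open>min 6 y \<le> 6 * y powr \<delta>\<close> for \<open>\<delta>\<close> in
  \<open>[0, 1]\<close>, a moment of order \<open>2 + \<delta>\<close> replaces the third moment;
  the \<open>6\<close> cancels against \<open>t\<^sup>2 / 6\<close>.\<close>

lemma (in real_distribution) char_approx_powr:
  assumes \<delta>: "0 \<le> \<delta>" "\<delta> \<le> 1"
    and "integrable M (\<lambda>x. x)" "expectation (\<lambda>x. x) = 0"
    and "integrable M (\<lambda>x. x\<^sup>2)" "variance (\<lambda>x. x) = \<sigma>2"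
    and int: "integrable M (\<lambda>x. \<bar>x\<bar> powr (2 + \<delta>))"
  shows "cmod (char M t - (1 - t\<^sup>2 * \<sigma>2 / 2)) \<le> \<bar>t\<bar> powr (2 + \<delta>) * expectation (\<lambda>x. \<bar>x\<bar> powr (2 + \<delta>))"
proof -
  have min_le: "min (6 * x\<^sup>2) (\<bar>t\<bar> * \<bar>x\<bar> ^ 3) \<le> 6 * (\<bar>t\<bar> powr \<delta> * \<bar>x\<bar> powr (2 + \<delta>))" for x
  proof (cases "x = 0 \<or> t = 0")
    case False
    define y where "y = \<bar>t\<bar> * \<bar>x\<bar>"
    have y: "y > 0" using False by (simp add: y_def)
    have eq: "\<bar>t\<bar> powr \<delta> * \<bar>x\<bar> powr (2 + \<delta>) = x\<^sup>2 * y powr \<delta>"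
      using False by (simp add: y_def powr_mult powr_add)
    show ?thesis
    proof (cases "y \<le> 1")
      case True
      have "y powr 1 \<le> y powr \<delta>" using y True \<delta> by (intro powr_mono') auto
      then have "x\<^sup>2 * y \<le> x\<^sup>2 * y powr \<delta>" using y by (intro mult_left_mono) auto
      also have "x\<^sup>2 * y = \<bar>t\<bar> * \<bar>x\<bar> ^ 3" by (simp add: y_def power2_eq_square power3_eq_cube)
      finally have "\<bar>t\<bar> * \<bar>x\<bar> ^ 3 \<le> 6 * (x\<^sup>2 * y powr \<delta>)" using y by (smt (verit) zero_le_mult_iff zero_le_power2 powr_ge_zero)
      then show ?thesis unfolding eq by simp
    next
      case False
      then have "1 \<le> y powr \<delta>" using \<delta> by (intro ge_one_powr_ge_zero) auto
      then have "x\<^sup>2 * 1 \<le> x\<^sup>2 * y powr \<delta>" by (intro mult_left_mono) auto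
      then show ?thesis unfolding eq by simp
    qed
  qed auto
  have "cmod (char M t - (1 - t\<^sup>2 * \<sigma>2 / 2)) \<le> (t\<^sup>2 / 6) * expectation (\<lambda>x. min (6 * x\<^sup>2) (\<bar>t\<bar> * \<bar>x\<bar> ^ 3))"
    by (rule char_approx3) fact+
  also have "\<dots> \<le> (t\<^sup>2 / 6) * expectation (\<lambda>x. 6 * (\<bar>t\<bar> powr \<delta> * \<bar>x\<bar> powr (2 + \<delta>)))"
  proof (rule mult_left_mono)
    have "integrable M (\<lambda>x. 6 * x\<^sup>2)" using assms by simp
    then have "integrable M (\<lambda>x. min (6 * x\<^sup>2) (\<bar>t\<bar> * \<bar>x\<bar> ^ 3))"
      by (rule Bochner_Integration.integrable_bound) auto
    moreover have "integrable M (\<lambda>x. 6 * (\<bar>t\<bar> powr \<delta> * \<bar>x\<bar> powr (2 + \<delta>)))"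
      by (intro integrable_mult_right int)
    ultimately show "expectation (\<lambda>x. min (6 * x\<^sup>2) (\<bar>t\<bar> * \<bar>x\<bar> ^ 3)) \<le> expectation (\<lambda>x. 6 * (\<bar>t\<bar> powr \<delta> * \<bar>x\<bar> powr (2 + \<delta>)))"
      by (rule integral_mono) (rule min_le)
  qed simp
  also have "\<dots> = \<bar>t\<bar> powr (2 + \<delta>) * expectation (\<lambda>x. \<bar>x\<bar> powr (2 + \<delta>))"
    by (cases "t = 0") (auto simp: powr_add)
  finally show ?thesis .
qed

lemma (in real_distribution) char_near_gaussian:
  assumes \<delta>: "0 < \<delta>" "\<delta> \<le> 1"
    and mom: "integrable M (\<lambda>x. x)" "expectation (\<lambda>x. x) = 0"
      "integrable M (\<lambda>x. x\<^sup>2)" "variance (\<lambda>x. x) = 1"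
    and int: "integrable M (\<lambda>x. \<bar>x\<bar> powr (2 + \<delta>))"
  obtains c B where "0 < c" "c \<le> 1" "B > 0"
    "\<And>u. \<bar>u\<bar> \<le> c \<Longrightarrow> cmod (char M u - exp (- (u\<^sup>2 / 2))) \<le> B * \<bar>u\<bar> powr (2 + \<delta>)"
    "\<And>u. \<bar>u\<bar> \<le> c \<Longrightarrow> cmod (char M u) \<le> exp (- (u\<^sup>2 / 4))"
proof -
  define \<beta> where "\<beta> = expectation (\<lambda>x. \<bar>x\<bar> powr (2 + \<delta>))"
  have \<beta>: "\<beta> \<ge> 0" unfolding \<beta>_def by (intro integral_nonneg_AE) auto
  have approx: "cmod (char M u - (1 - u\<^sup>2 / 2)) \<le> \<beta> * \<bar>u\<bar> powr (2 + \<delta>)" for u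
    using char_approx_powr[OF _ \<delta>(2) mom int, of u] \<delta> by (simp add: \<beta>_def mult.commute)
  \<comment> \<open>Chosen so that the Taylor error is at most \<open>u\<^sup>2 / 4\<close>, half of
    the quadratic term. This leaves \<open>1 - u\<^sup>2 / 4 \<le> exp (- (u\<^sup>2 / 4))\<close>
    as a bound for the modulus. The \<open>+ 1\<close> covers \<open>\<beta> = 0\<close>.\<close>
  define c where "c = min 1 ((1 / (4 * (\<beta> + 1))) powr (1 / \<delta>))"
  have c: "0 < c" "c \<le> 1" using \<beta> by (auto simp: c_def)
  have c4: "\<beta> * \<bar>u\<bar> powr \<delta> \<le> 1 / 4" if "\<bar>u\<bar> \<le> c" for u
  proof -
    have "\<bar>u\<bar> powr \<delta> \<le> ((1 / (4 * (\<beta> + 1))) powr (1 / \<delta>)) powr \<delta>"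
      using that \<delta> by (intro powr_mono2) (auto simp: c_def)
    also have "\<dots> = 1 / (4 * (\<beta> + 1))" using \<delta> \<beta> by (simp add: powr_powr)
    finally have "\<beta> * \<bar>u\<bar> powr \<delta> \<le> \<beta> * (1 / (4 * (\<beta> + 1)))" using \<beta> by (intro mult_left_mono)
    also have "\<dots> \<le> 1 / 4" using \<beta> by (simp add: field_simps)
    finally show ?thesis .
  qed
  show ?thesis
  proof (rule that[OF c, of "\<beta> + 1"])
    fix u assume u: "\<bar>u\<bar> \<le> c"
    \<comment> \<open>Replacing \<open>1 - u\<^sup>2 / 2\<close> by the Gaussian costs order
      \<open>u ^ 4\<close>, which is absorbed because \<open>\<bar>u\<bar> \<le> 1\<close> and
      \<open>2 + \<delta> \<le> 4\<close>. It accounts for the \<open>1\<close> in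
      \<open>\<beta> + 1\<close>.\<close>
    have "u ^ 4 = \<bar>u\<bar> powr 4" by (simp add: power_even_abs)
    also have "\<dots> \<le> \<bar>u\<bar> powr (2 + \<delta>)" using u c \<delta> by (intro powr_mono') auto
    finally have u4: "u ^ 4 \<le> \<bar>u\<bar> powr (2 + \<delta>)" .
    have "\<bar>1 - u\<^sup>2 / 2 - exp (- (u\<^sup>2 / 2))\<bar> \<le> (u\<^sup>2 / 2)\<^sup>2 / 2"
      using exp_minus_le_quadratic[of "u\<^sup>2 / 2"] exp_ge_add_one_self[of "- (u\<^sup>2 / 2)"] by simp
    also have "\<dots> \<le> u ^ 4" by (simp add: power_divide power_mult[symmetric])
    finally have "\<bar>1 - u\<^sup>2 / 2 - exp (- (u\<^sup>2 / 2))\<bar> \<le> \<bar>u\<bar> powr (2 + \<delta>)" using u4 by simp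
    then have "cmod (of_real (1 - u\<^sup>2 / 2 - exp (- (u\<^sup>2 / 2)))) \<le> \<bar>u\<bar> powr (2 + \<delta>)" by (simp only: norm_of_real)
    then have "cmod ((char M u - (1 - u\<^sup>2 / 2)) + of_real (1 - u\<^sup>2 / 2 - exp (- (u\<^sup>2 / 2)))) \<le> \<beta> * \<bar>u\<bar> powr (2 + \<delta>) + \<bar>u\<bar> powr (2 + \<delta>)"
      by (intro norm_triangle_le add_mono approx)
    then show "cmod (char M u - exp (- (u\<^sup>2 / 2))) \<le> (\<beta> + 1) * \<bar>u\<bar> powr (2 + \<delta>)"
      by (simp add: algebra_simps)
    have u2: "u\<^sup>2 \<le> 1" using u c by (metis abs_square_le_1 order_trans)
    have "cmod (char M u) \<le> cmod (char M u - (1 - u\<^sup>2 / 2)) + cmod (of_real (1 - u\<^sup>2 / 2))"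
      using norm_triangle_ineq[of "char M u - (1 - u\<^sup>2 / 2)" "of_real (1 - u\<^sup>2 / 2)"] by simp
    also have "cmod (of_real (1 - u\<^sup>2 / 2)) = 1 - u\<^sup>2 / 2" unfolding norm_of_real using u2 by simp
    also have "cmod (char M u - (1 - u\<^sup>2 / 2)) \<le> u\<^sup>2 * (\<beta> * \<bar>u\<bar> powr \<delta>)"
      using approx[of u] by (cases "u = 0") (auto simp: powr_add mult_ac)
    also have "u\<^sup>2 * (\<beta> * \<bar>u\<bar> powr \<delta>) \<le> u\<^sup>2 * (1 / 4)" by (intro mult_left_mono c4 u) simp
    also have "u\<^sup>2 * (1 / 4) + (1 - u\<^sup>2 / 2) \<le> exp (- (u\<^sup>2 / 4))"
      using exp_ge_add_one_self[of "- (u\<^sup>2 / 4)"] by simp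
    finally show "cmod (char M u) \<le> exp (- (u\<^sup>2 / 4))" by simp
  qed (use \<beta> in simp)
qed

text \<open>The density is at most \<open>1\<close>. The explicit factor \<open>1\<close> matches
  the Lipschitz hypothesis of the smoothing inequality with \<open>m = 1\<close>.\<close>

lemma std_normal_cdf_lipschitz:
  assumes "x \<le> y"
  shows "cdf std_normal_distribution y - cdf std_normal_distribution x \<le> 1 * (y - x)"
proof (cases "x = y")
  case False
  interpret N: real_distribution std_normal_distribution by (rule real_dist_normal_dist)
  have le1: "std_normal_density z \<le> 1" for z
  proof -
    have "std_normal_density z \<le> 1 * 1" unfolding std_normal_density_def
      using pi_ge_two by (intro mult_mono) (auto simp: real_le_rsqrt)
    then show ?thesis by simp
  qed
  have "cdf std_normal_distribution y - cdf std_normal_distribution x = measure std_normal_distribution {x<..y}"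
    using assms False by (intro N.cdf_diff_eq) auto
  also have "\<dots> \<le> y - x"
  proof -
    have "emeasure std_normal_distribution {x<..y} = (\<integral>\<^sup>+z. ennreal (std_normal_density z) * indicator {x<..y} z \<partial>lborel)"
      by (subst emeasure_density) auto
    also have "\<dots> \<le> (\<integral>\<^sup>+z. indicator {x<..y} z \<partial>lborel)"
      using le1 by (intro nn_integral_mono) (auto split: split_indicator simp: ennreal_le_1)
    also have "\<dots> = ennreal (y - x)" using assms by simp
    finally show ?thesis using assms by (simp add: N.emeasure_eq_measure)
  qed
  finally show ?thesis by simp
qed simp

text \<open>Up to the factor \<open>sqrt (4 * pi)\<close>, the exponential is the normal density
  with variance \<open>2\<close>, so its moments of order \<open>0\<close> and \<open>2\<close>
  suffice.\<close>

lemma integrable_quadratic_gaussian: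
  "integrable lborel (\<lambda>t::real. (1 + t\<^sup>2) * exp (- (t\<^sup>2 / 4)))"
proof -
  have "integrable lborel (\<lambda>t. sqrt (4 * pi) * (normal_density 0 (sqrt 2) t * (t - 0) ^ 0) + sqrt (4 * pi) * (normal_density 0 (sqrt 2) t * (t - 0)\<^sup>2))"
    by (intro Bochner_Integration.integrable_add integrable_mult_right integrable_normal_moment) auto
  then show ?thesis
    by (rule Bochner_Integration.integrable_cong[THEN iffD1, rotated 2]) (auto simp: normal_density_def field_simps)
qed

lemma (in prob_space) berry_esseen:
  fixes X :: "nat \<Rightarrow> 'a \<Rightarrow> real"
  assumes \<delta>: "0 < \<delta>" "\<delta> \<le> 1"
    and indep: "indep_vars (\<lambda>_. borel) X {1..}"
    and distr: "\<And>i. i \<ge> 1 \<Longrightarrow> distr M borel (X i) = distr M borel (X 1)"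
    and mean: "expectation (X 1) = 0"
    and var: "expectation (\<lambda>\<omega>. (X 1 \<omega>)\<^sup>2) = 1"
    and moment: "integrable M (\<lambda>\<omega>. \<bar>X 1 \<omega>\<bar> powr (2 + \<delta>))"
  obtains C where "C > 0"
    "\<And>n x. n \<ge> 1 \<Longrightarrow> \<bar>cdf (distr M borel (\<lambda>\<omega>. (\<Sum>k=1..n. X k \<omega>) / sqrt n)) x
       - cdf std_normal_distribution x\<bar> \<le> C * real n powr (- \<delta> / 2)"
proof -
  have rv [measurable]: "random_variable borel (X i)" if "i \<ge> 1" for i
    using indep that unfolding indep_vars_def2 by auto
  define \<mu> where "\<mu> = distr M borel (X 1)"
  interpret \<mu>: real_distribution \<mu> unfolding \<mu>_def by (rule real_distribution_distr) (simp add: rv)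
  \<comment> \<open>A function that is not integrable has Bochner integral \<open>0\<close>, so the
    value \<open>1\<close> in \<open>var\<close> already carries integrability.\<close>
  have sq: "integrable M (\<lambda>\<omega>. (X 1 \<omega>)\<^sup>2)"
    using var not_integrable_integral_eq by fastforce
  have int1: "integrable M (X 1)"
    by (rule square_integrable_imp_integrable[OF _ sq]) (simp add: rv)
  have mom: "integrable \<mu> (\<lambda>x. x)" "\<mu>.expectation (\<lambda>x. x) = 0" "integrable \<mu> (\<lambda>x. x\<^sup>2)"
    "\<mu>.expectation (\<lambda>x. x\<^sup>2) = 1" "integrable \<mu> (\<lambda>x. \<bar>x\<bar> powr (2 + \<delta>))"
    using sq int1 mean var moment rv[of 1] unfolding \<mu>_def
    by (simp_all add: integrable_distr_eq integral_distr)
  have var1: "\<mu>.variance (\<lambda>x. x) = 1" using mom(2,4) by simp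
  obtain c B where c: "0 < c" "c \<le> 1" and B: "B > 0"
    and near: "\<And>u. \<bar>u\<bar> \<le> c \<Longrightarrow> cmod (char \<mu> u - exp (- (u\<^sup>2 / 2))) \<le> B * \<bar>u\<bar> powr (2 + \<delta>)"
    and small: "\<And>u. \<bar>u\<bar> \<le> c \<Longrightarrow> cmod (char \<mu> u) \<le> exp (- (u\<^sup>2 / 4))"
    by (rule \<mu>.char_near_gaussian[OF \<delta> mom(1-3) var1 mom(5)]) (rule that)
  obtain E where E: "E > 0" and smoothing: "\<And>P Q m T g x. real_distribution P \<Longrightarrow> real_distribution Q \<Longrightarrow> T > 0 \<Longrightarrow>
      (\<And>x y. x \<le> y \<Longrightarrow> cdf Q y - cdf Q x \<le> m * (y - x)) \<Longrightarrow>
      integrable lborel g \<Longrightarrow> (\<And>t. g t \<ge> 0) \<Longrightarrow>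
      (\<And>t. \<bar>t\<bar> \<le> T \<Longrightarrow> cmod (char P t - char Q t) \<le> \<bar>t\<bar> * g t) \<Longrightarrow>
      \<bar>cdf P x - cdf Q x\<bar> \<le> E * ((LINT t|lborel. g t) + m / T)"
  proof (rule esseen_smoothing, goal_cases)
    case (1 C)
    show ?case by (rule 1(1)[OF 1(2)]) (rule 1(3))
  qed
  define J where "J = (LINT t|lborel. (1 + (t::real)\<^sup>2) * exp (- (t\<^sup>2 / 4)))"
  have J: "J \<ge> 0" unfolding J_def by (intro integral_nonneg_AE) auto
  show ?thesis
  proof (rule that[of "E * (2 * B * J + 1 / c)"])
    show "E * (2 * B * J + 1 / c) > 0" using E B J c by (intro mult_pos_pos add_nonneg_pos) auto
    fix n :: nat and x :: real assume n: "n \<ge> 1"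
    define P where "P = distr M borel (\<lambda>\<omega>. (\<Sum>k=1..n. X k \<omega>) / sqrt n)"
    have P: "real_distribution P"
      unfolding P_def by (intro real_distribution_distr borel_measurable_divide borel_measurable_sum) (auto simp: rv)
    have charP: "char P t = char \<mu> (t / sqrt n) ^ n" for t
    proof -
      have "char P t = char (distr M borel (\<lambda>\<omega>. \<Sum>k\<in>{1..n}. X k \<omega> / sqrt n)) t"
        by (simp add: P_def sum_divide_distrib)
      also have "\<dots> = (\<Prod>k\<in>{1..n}. char (distr M borel (\<lambda>\<omega>. X k \<omega> / sqrt n)) t)"
      proof (rule char_distr_sum)
        have "indep_vars (\<lambda>_. borel) X {1..n}" by (rule indep_vars_subset[OF indep]) auto
        then show "indep_vars (\<lambda>_. borel) (\<lambda>k \<omega>. X k \<omega> / sqrt n) {1..n}"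
          by (rule indep_vars_compose2) auto
      qed
      also have "\<dots> = (\<Prod>k\<in>{1..n}. char \<mu> (t / sqrt n))"
      proof (intro prod.cong refl)
        fix k assume k: "k \<in> {1..n}"
        have "char (distr M borel (\<lambda>\<omega>. X k \<omega> / sqrt n)) t = char (distr M borel (X k)) (t / sqrt n)"
          unfolding char_def using k rv[of k] by (subst (1 2) integral_distr) auto
        then show "char (distr M borel (\<lambda>\<omega>. X k \<omega> / sqrt n)) t = char \<mu> (t / sqrt n)"
          using k distr[of k] by (simp add: \<mu>_def)
      qed
      finally show ?thesis by simp
    qed
    \<comment> \<open>The weight \<open>1 + t\<^sup>2\<close> dominates
      \<open>\<bar>t\<bar> powr (1 + \<delta>)\<close>, the factor left after removing one
      \<open>\<bar>t\<bar>\<close>. All dependence on \<open>n\<close> sits in the scalar in front,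
      so the integral is a fixed multiple of \<open>J\<close>.\<close>
    define g where "g t = 2 * B * real n powr (- \<delta> / 2) * ((1 + t\<^sup>2) * exp (- (t\<^sup>2 / 4)))" for t
    have g: "integrable lborel g" unfolding g_def[abs_def]
      by (intro integrable_mult_right integrable_quadratic_gaussian)
    have g0: "g t \<ge> 0" for t using B by (simp add: g_def)
    have key: "cmod (char P t - char std_normal_distribution t) \<le> \<bar>t\<bar> * g t" if t: "\<bar>t\<bar> \<le> c * sqrt n" for t
    proof -
      define u where "u = t / sqrt n"
      have u: "\<bar>u\<bar> \<le> c" using t n by (simp add: u_def field_simps)
      have nu: "n * u\<^sup>2 = t\<^sup>2" using n by (simp add: u_def power_divide)
      have u1: "u\<^sup>2 \<le> 1" using u c by (metis abs_square_le_1 order_trans)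
      have G: "char std_normal_distribution t = complex_of_real (exp (- (u\<^sup>2 / 2))) ^ n"
      proof -
        have "exp (- (u\<^sup>2 / 2)) ^ n = exp (- (t\<^sup>2) / 2)" by (simp add: exp_of_nat_mult[symmetric] nu)
        then show ?thesis unfolding char_std_normal_distribution by (simp only: of_real_power[symmetric])
      qed
      have "cmod (char P t - char std_normal_distribution t) = cmod (char \<mu> u ^ n - complex_of_real (exp (- (u\<^sup>2 / 2))) ^ n)"
        unfolding G charP u_def ..
      also have "\<dots> \<le> n * exp (- (u\<^sup>2 / 4)) ^ (n - 1) * cmod (char \<mu> u - exp (- (u\<^sup>2 / 2)))"
        by (rule norm_power_diff_le[OF small[OF u]]) (auto simp: norm_of_real)
      also have "\<dots> \<le> n * (2 * exp (- (t\<^sup>2 / 4))) * (B * \<bar>u\<bar> powr (2 + \<delta>))"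
      proof (intro mult_mono mult_left_mono near[OF u])
        \<comment> \<open>With \<open>n - 1\<close> instead of \<open>n\<close> factors the exponent
          misses \<open>u\<^sup>2 / 4\<close>; as \<open>\<bar>u\<bar> \<le> 1\<close>, restoring it
          costs at most the factor \<open>2\<close> that appears in \<open>g\<close>.\<close>
        have "exp (- (u\<^sup>2 / 4)) ^ (n - 1) = exp (u\<^sup>2 / 4) * exp (- (t\<^sup>2 / 4))"
        proof -
          have "real (n - 1) * (- (u\<^sup>2 / 4)) = u\<^sup>2 / 4 + - (t\<^sup>2 / 4)"
            using n by (simp add: of_nat_diff left_diff_distrib nu[symmetric] diff_divide_distrib)
          then show ?thesis by (simp only: exp_of_nat_mult[symmetric] exp_add[symmetric])
        qed
        also have "exp (u\<^sup>2 / 4) \<le> exp (1 / 2)" using u1 by simp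
        also have "exp (1 / 2) \<le> (2 :: real)" by (rule exp_half_le2)
        finally show "exp (- (u\<^sup>2 / 4)) ^ (n - 1) \<le> 2 * exp (- (t\<^sup>2 / 4))" by simp
      qed auto
      also have "\<dots> = 2 * B * exp (- (t\<^sup>2 / 4)) * (n * \<bar>u\<bar> powr (2 + \<delta>))" by simp
      also have "n * \<bar>u\<bar> powr (2 + \<delta>) = real n powr (- \<delta> / 2) * \<bar>t\<bar> powr (2 + \<delta>)"
      proof -
        have "\<bar>u\<bar> powr (2 + \<delta>) = \<bar>t\<bar> powr (2 + \<delta>) / (real n powr (1 / 2)) powr (2 + \<delta>)"
          using n by (simp add: u_def powr_divide powr_half_sqrt abs_divide)
        also have "(real n powr (1 / 2)) powr (2 + \<delta>) = real n powr (1 + \<delta> / 2)"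
          by (simp add: powr_powr add_divide_distrib)
        also have "\<dots> = real n * real n powr (\<delta> / 2)" using n by (simp add: powr_add)
        finally have "\<bar>u\<bar> powr (2 + \<delta>) = \<bar>t\<bar> powr (2 + \<delta>) / (real n * real n powr (\<delta> / 2))" .
        moreover have "real n powr (- \<delta> / 2) = 1 / real n powr (\<delta> / 2)"
          using powr_minus_divide[of "real n" "\<delta> / 2"] by simp
        ultimately show ?thesis using n by simp
      qed
      also have "2 * B * exp (- (t\<^sup>2 / 4)) * (real n powr (- \<delta> / 2) * \<bar>t\<bar> powr (2 + \<delta>))
        \<le> 2 * B * exp (- (t\<^sup>2 / 4)) * (real n powr (- \<delta> / 2) * (\<bar>t\<bar> * (1 + t\<^sup>2)))"
      proof (intro mult_left_mono)
        have "\<bar>t\<bar> powr (1 + \<delta>) \<le> 1 + t\<^sup>2"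
        proof (cases "\<bar>t\<bar> \<le> 1")
          case True
          then have "\<bar>t\<bar> powr (1 + \<delta>) \<le> 1" using \<delta> by (intro powr_le1) auto
          then show ?thesis using zero_le_power2[of t] by linarith
        next
          case False
          then have "\<bar>t\<bar> powr (1 + \<delta>) \<le> \<bar>t\<bar> powr 2" using \<delta> by (intro powr_mono) auto
          then show ?thesis using False by simp
        qed
        then have "\<bar>t\<bar> * \<bar>t\<bar> powr (1 + \<delta>) \<le> \<bar>t\<bar> * (1 + t\<^sup>2)" by (intro mult_left_mono) auto
        moreover have "\<bar>t\<bar> powr (2 + \<delta>) = \<bar>t\<bar> * \<bar>t\<bar> powr (1 + \<delta>)"
          using \<delta> powr_add[of "\<bar>t\<bar>" 1 "1 + \<delta>"] by (cases "t = 0") (auto simp: add.assoc[symmetric])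
        ultimately show "\<bar>t\<bar> powr (2 + \<delta>) \<le> \<bar>t\<bar> * (1 + t\<^sup>2)" by simp
      qed (use B in auto)
      finally show ?thesis by (simp add: g_def mult_ac)
    qed
    \<comment> \<open>Here \<open>T = c * sqrt n\<close>, the largest range for which
      \<open>t / sqrt n\<close> stays in the neighbourhood of the origin controlled by
      \<open>c\<close>. The resulting \<open>1 / sqrt n\<close> is within the rate because
      \<open>\<delta> \<le> 1\<close>.\<close>
    have "\<bar>cdf P x - cdf std_normal_distribution x\<bar> \<le> E * ((LINT t|lborel. g t) + 1 / (c * sqrt n))"
      using n c by (intro smoothing P real_dist_normal_dist std_normal_cdf_lipschitz g g0 key) auto
    also have "\<dots> \<le> E * (2 * B * real n powr (- \<delta> / 2) * J + 1 / c * real n powr (- \<delta> / 2))"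
    proof (intro mult_left_mono add_mono)
      show "(LINT t|lborel. g t) \<le> 2 * B * real n powr (- \<delta> / 2) * J"
        unfolding g_def J_def by simp
      have "1 / sqrt n = real n powr (- 1 / 2)" using n powr_minus_divide[of "real n" "1 / 2"] by (simp add: powr_half_sqrt)
      also have "\<dots> \<le> real n powr (- \<delta> / 2)" using n \<delta> by (intro powr_mono) auto
      finally have "1 / c * (1 / sqrt n) \<le> 1 / c * real n powr (- \<delta> / 2)" using c by (intro mult_left_mono) auto
      then show "1 / (c * sqrt n) \<le> 1 / c * real n powr (- \<delta> / 2)" by simp
    qed (use E in simp)
    also have "\<dots> = E * (2 * B * J + 1 / c) * real n powr (- \<delta> / 2)" by (simp add: algebra_simps)
    finally show "\<bar>cdf (distr M borel (\<lambda>\<omega>. (\<Sum>k=1..n. X k \<omega>) / sqrt n)) x - cdf std_normal_distribution x\<bar>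
      \<le> E * (2 * B * J + 1 / c) * real n powr (- \<delta> / 2)" unfolding P_def .
  qed
qed

subsection \<open>Sampling from a countable alphabet\<close>

declare One_nat_def [simp del]

locale discrete_sample = prob_space M for M :: "'w measure" +
  fixes a :: "nat \<Rightarrow> 'a" and X :: "nat \<Rightarrow> 'w \<Rightarrow> 'a" and p :: "nat \<Rightarrow> real"
  assumes inj_a: "inj_on a {1..}"
    and indep_X: "indep_vars (\<lambda>_. count_space (a ` {1..})) X {1..}"
    and distr_X: "\<And>n. n \<ge> 1 \<Longrightarrow> distr M (count_space (a ` {1..})) (X n) = distr M (count_space (a ` {1..})) (X 1)"
    and p_eq: "\<And>i. i \<ge> 1 \<Longrightarrow> p i = letter_prob M (X 1) (a i)"
begin

text \<open>Passing from letters to their indices gives an i.i.d. sample of natural numbers with the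
  discrete sigma-algebra. The inverse is meaningful only for values in the alphabet, hence the side
  conditions \<open>\<omega> \<in> space M\<close> below.\<close>

definition idx :: "nat \<Rightarrow> 'w \<Rightarrow> nat" where
  "idx k \<omega> = the_inv_into {1..} a (X k \<omega>)"

lemma measurable_X: "k \<ge> 1 \<Longrightarrow> X k \<in> measurable M (count_space (a ` {1..}))"
  using indep_X unfolding indep_vars_def2 by auto

lemma idx_measurable [measurable]: "k \<ge> 1 \<Longrightarrow> idx k \<in> measurable M (count_space UNIV)"
  unfolding idx_def[abs_def] by (rule measurable_compose[OF measurable_X]) auto

lemma X_eq_iff: "k \<ge> 1 \<Longrightarrow> i \<ge> 1 \<Longrightarrow> \<omega> \<in> space M \<Longrightarrow> X k \<omega> = a i \<longleftrightarrow> idx k \<omega> = i"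
  using measurable_space[OF measurable_X, of k \<omega>] inj_a
  by (auto simp: idx_def the_inv_into_f_f inj_on_eq_iff[OF inj_a])

lemma idx_ge_1: "k \<ge> 1 \<Longrightarrow> \<omega> \<in> space M \<Longrightarrow> idx k \<omega> \<ge> 1"
  using measurable_space[OF measurable_X, of k \<omega>] inj_a
  by (auto simp: idx_def the_inv_into_f_f)

lemma X_eq_a_idx: "k \<ge> 1 \<Longrightarrow> \<omega> \<in> space M \<Longrightarrow> X k \<omega> = a (idx k \<omega>)"
  using X_eq_iff idx_ge_1 by blast

lemma indep_idx: "indep_vars (\<lambda>_. count_space UNIV) idx {1..}"
  unfolding idx_def[abs_def] by (rule indep_vars_compose2[OF indep_X]) auto

lemma distr_idx:
  assumes "k \<ge> 1"
  shows "distr M (count_space UNIV) (idx k) = distr M (count_space UNIV) (idx 1)"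
proof -
  have "distr M (count_space UNIV) (idx j)
      = distr (distr M (count_space (a ` {1..})) (X j)) (count_space UNIV) (the_inv_into {1..} a)" if "j \<ge> 1" for j
    using measurable_X[OF that] by (subst distr_distr) (auto simp: comp_def idx_def[abs_def])
  then show ?thesis using assms distr_X[OF assms] by simp
qed

lemma letter_prob_X: "k \<ge> 1 \<Longrightarrow> \<omega> \<in> space M \<Longrightarrow> letter_prob M (X 1) (X k \<omega>) = p (idx k \<omega>)"
  using X_eq_a_idx idx_ge_1 p_eq by simp

lemma prob_idx_1: "i \<ge> 1 \<Longrightarrow> prob {\<omega> \<in> space M. idx 1 \<omega> = i} = p i"
  unfolding p_eq letter_prob_def by (intro arg_cong[where f=prob]) (auto simp: X_eq_iff)

lemma expectation_idx:
  fixes f :: "nat \<Rightarrow> real"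
  assumes "k \<ge> 1"
  shows "expectation (\<lambda>\<omega>. f (idx k \<omega>)) = expectation (\<lambda>\<omega>. f (idx 1 \<omega>))"
    and "integrable M (\<lambda>\<omega>. f (idx k \<omega>)) \<longleftrightarrow> integrable M (\<lambda>\<omega>. f (idx 1 \<omega>))"
proof -
  have "expectation (\<lambda>\<omega>. f (idx j \<omega>)) = (LINT i|distr M (count_space UNIV) (idx j). f i)" if "j \<ge> 1" for j
    using that by (subst integral_distr) auto
  then show "expectation (\<lambda>\<omega>. f (idx k \<omega>)) = expectation (\<lambda>\<omega>. f (idx 1 \<omega>))"
    using distr_idx[OF assms] assms by simp
  have "integrable M (\<lambda>\<omega>. f (idx j \<omega>)) \<longleftrightarrow> integrable (distr M (count_space UNIV) (idx j)) f" if "j \<ge> 1" for j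
    using that by (subst integrable_distr_eq) auto
  then show "integrable M (\<lambda>\<omega>. f (idx k \<omega>)) \<longleftrightarrow> integrable M (\<lambda>\<omega>. f (idx 1 \<omega>))"
    using distr_idx[OF assms] assms by simp
qed

lemma prob_idx:
  assumes "k \<ge> 1" "i \<ge> 1"
  shows "prob {\<omega> \<in> space M. idx k \<omega> = i} = p i"
proof -
  have "prob {\<omega> \<in> space M. idx j \<omega> = i} = measure (distr M (count_space UNIV) (idx j)) {i}" if "j \<ge> 1" for j
    using that by (subst measure_distr) (auto intro!: arg_cong[where f=prob])
  then show ?thesis using assms distr_idx[OF assms(1)] prob_idx_1[OF assms(2)] by simp
qed

lemma p_nonneg: "i \<ge> 1 \<Longrightarrow> p i \<ge> 0"
  by (simp add: p_eq letter_prob_def)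

text \<open>The law of \<open>idx 1\<close> has a density with respect to counting measure.
  Integrability gives absolute summability, so that \<open>infsum\<close> is the actual sum rather
  than its default \<open>0\<close>. Entropy, entropy tail and tail mass all become expectations
  this way.\<close>

lemma infsum_eq_expectation:
  fixes f :: "nat \<Rightarrow> real"
  assumes int: "integrable M (\<lambda>\<omega>. f (idx 1 \<omega>))" and S: "S \<subseteq> {1..}"
  shows "(\<Sum>\<^sub>\<infinity>i\<in>S. p i * f i) = expectation (\<lambda>\<omega>. f (idx 1 \<omega>) * indicator S (idx 1 \<omega>))"
proof -
  define D where "D = distr M (count_space UNIV) (idx 1)"
  \<comment> \<open>The density must be right at every natural number, whereas \<open>p 0\<close> is
    unconstrained. The true probabilities \<open>q\<close> are used until the sum has been
    restricted to \<open>S \<subseteq> {1..}\<close>, where they agree with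
    \<open>p\<close>.\<close>
  define q where "q i = prob {\<omega> \<in> space M. idx 1 \<omega> = i}" for i
  have D: "D = density (count_space UNIV) (\<lambda>i. ennreal (q i))"
  proof (rule measure_eqI_countable)
    show "emeasure D {i} = emeasure (density (count_space UNIV) (\<lambda>i. ennreal (q i))) {i}" for i
      unfolding D_def
      by (subst emeasure_distr, simp, simp, subst emeasure_density)
         (auto simp: q_def emeasure_eq_measure nn_integral_count_space_indicator[symmetric]
            nn_integral_count_space_finite one_ennreal_def[symmetric] intro!: arg_cong[where f=prob])
  qed (auto simp: D_def)
  have q0: "q i \<ge> 0" for i by (simp add: q_def)
  have "integrable D f" unfolding D_def using int by (subst integrable_distr_eq) auto
  then have intq: "integrable (count_space UNIV) (\<lambda>i. q i * f i)"
    unfolding D by (subst (asm) integrable_density) (auto simp: q0)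
  have "expectation (\<lambda>\<omega>. f (idx 1 \<omega>) * indicator S (idx 1 \<omega>)) = (LINT i|D. f i * indicator S i)"
    unfolding D_def by (subst integral_distr) auto
  also have "\<dots> = (LINT i|count_space UNIV. q i * (f i * indicator S i))"
    unfolding D by (subst integral_density) (auto simp: q0)
  also have "\<dots> = infsetsum (\<lambda>i. q i * (f i * indicator S i)) UNIV" by (simp add: infsetsum_def)
  also have "\<dots> = infsum (\<lambda>i. q i * (f i * indicator S i)) UNIV"
  proof (rule infsetsum_infsum)
    have "integrable (count_space UNIV) (\<lambda>i. (q i * f i) * indicator S i)"
      by (rule Bochner_Integration.integrable_bound[OF intq]) (auto split: split_indicator)
    then show "Infinite_Set_Sum.abs_summable_on (\<lambda>i. q i * (f i * indicator S i)) UNIV"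
      by (simp add: Infinite_Set_Sum.abs_summable_on_def mult.assoc)
  qed
  also have "\<dots> = infsum (\<lambda>i. p i * f i) S"
    using S by (intro infsum_cong_neutral) (auto simp: q_def prob_idx_1)
  finally show ?thesis by simp
qed

lemma sum_p_le_1:
  assumes "finite S" "S \<subseteq> {1..}"
  shows "sum p S \<le> 1"
proof -
  have "sum p S = (\<Sum>i\<in>S. prob {\<omega> \<in> space M. idx 1 \<omega> = i})"
    using assms by (intro sum.cong) (auto simp: prob_idx_1)
  also have "\<dots> = prob (\<Union>i\<in>S. {\<omega> \<in> space M. idx 1 \<omega> = i})"
    using assms(1) by (intro finite_measure_finite_Union[symmetric]) (auto simp: disjoint_family_on_def)
  finally show ?thesis by simp
qed

text \<open>Each observation meets a given null letter with probability zero, and there are only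
  countably many letters and observations. This keeps the defaults of \<open>ln 0\<close> and of
  division by \<open>0\<close> out of the pointwise estimates.\<close>

lemma AE_p_idx_pos: "AE \<omega> in M. \<forall>k\<in>{1..}. p (idx k \<omega>) > 0"
proof (rule AE_ball_countable')
  fix k :: nat assume k: "k \<in> {1..}"
  have "AE \<omega> in M. \<forall>i. i \<ge> 1 \<and> p i = 0 \<longrightarrow> idx k \<omega> \<noteq> i"
  proof (subst AE_all_countable, rule allI)
    fix i
    show "AE \<omega> in M. i \<ge> 1 \<and> p i = 0 \<longrightarrow> idx k \<omega> \<noteq> i"
    proof (cases "i \<ge> 1 \<and> p i = 0")
      case True
      then have "prob {\<omega> \<in> space M. idx k \<omega> = i} = 0" using k prob_idx by simp
      then show ?thesis using k by (intro AE_I[where N="{\<omega> \<in> space M. idx k \<omega> = i}"]) (auto simp: emeasure_eq_measure)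
    qed auto
  qed
  then show "AE \<omega> in M. p (idx k \<omega>) > 0"
  proof (rule AE_mp, intro AE_I2 impI)
    fix \<omega> assume "\<omega> \<in> space M" "\<forall>i. i \<ge> 1 \<and> p i = 0 \<longrightarrow> idx k \<omega> \<noteq> i"
    then show "p (idx k \<omega>) > 0" using k idx_ge_1[of k \<omega>] p_nonneg[of "idx k \<omega>"] by force
  qed
qed simp

section \<open>Letter counts and the estimator as finite sums\<close>

definition cnt :: "nat \<Rightarrow> 'w \<Rightarrow> nat \<Rightarrow> nat" where
  "cnt n \<omega> i = (\<Sum>k=1..n. of_bool (idx k \<omega> = i))"

lemma cnt_eq: "\<omega> \<in> space M \<Longrightarrow> i \<ge> 1 \<Longrightarrow> letter_count a X n \<omega> i = cnt n \<omega> i"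
  unfolding letter_count_def cnt_def by (intro sum.cong) (auto simp: X_eq_iff)

lemma cnt_pos_iff: "cnt n \<omega> i > 0 \<longleftrightarrow> i \<in> (\<lambda>k. idx k \<omega>) ` {1..n}"
proof -
  have "cnt n \<omega> i = 0 \<longleftrightarrow> (\<forall>k\<in>{1..n}. idx k \<omega> \<noteq> i)"
    by (auto simp: cnt_def)
  then show ?thesis by (metis (no_types, lifting) imageE image_eqI gr0I less_irrefl)
qed

lemma cnt_le: "cnt n \<omega> i \<le> n"
proof -
  have "cnt n \<omega> i \<le> (\<Sum>k=1..n. 1)" unfolding cnt_def by (intro sum_mono) auto
  then show ?thesis by simp
qed

text \<open>Double counting: expand each count into observations and swap the sums, after which each
  observation selects exactly one letter.\<close>

lemma sum_cnt_mult:
  fixes f :: "nat \<Rightarrow> real"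
  shows "(\<Sum>i\<in>(\<lambda>k. idx k \<omega>) ` {1..n}. cnt n \<omega> i * f i) = (\<Sum>k=1..n. f (idx k \<omega>))"
proof -
  let ?S = "(\<lambda>k. idx k \<omega>) ` {1..n}"
  have "(\<Sum>i\<in>?S. cnt n \<omega> i * f i) = (\<Sum>i\<in>?S. \<Sum>k=1..n. of_bool (idx k \<omega> = i) * f i)"
    by (simp add: cnt_def sum_distrib_right)
  also have "\<dots> = (\<Sum>k=1..n. \<Sum>i\<in>?S. of_bool (idx k \<omega> = i) * f i)" by (rule sum.swap)
  also have "\<dots> = (\<Sum>k=1..n. f (idx k \<omega>))"
  proof (intro sum.cong refl)
    fix k assume "k \<in> {1..n}"
    then have "(\<Sum>i\<in>?S. if i = idx k \<omega> then f i else 0) = f (idx k \<omega>)" by (subst sum.delta) auto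
    moreover have "of_bool (idx k \<omega> = i) * f i = (if i = idx k \<omega> then f i else 0)" for i by auto
    ultimately show "(\<Sum>i\<in>?S. of_bool (idx k \<omega> = i) * f i) = f (idx k \<omega>)" by simp
  qed
  finally show ?thesis .
qed

lemma distinct_letters_eq:
  assumes "\<omega> \<in> space M"
  shows "distinct_letters a X n \<omega> = card ((\<lambda>k. idx k \<omega>) ` {1..n})"
proof -
  let ?S = "(\<lambda>k. idx k \<omega>) ` {1..n}"
  have "distinct_letters a X n \<omega> = (\<Sum>\<^sub>\<infinity>i\<in>?S. 1)"
    unfolding distinct_letters_def using assms idx_ge_1
    by (intro infsum_cong_neutral) (auto simp: cnt_eq cnt_pos_iff)
  then show ?thesis by simp
qed

text \<open>Unobserved letters contribute \<open>0 * ln 0 = 0\<close>. The division by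
  \<open>n\<close> is attached to the logarithm so that each summand has the shape
  \<open>cnt * f\<close> treated by \<open>sum_cnt_mult\<close>.\<close>

lemma plugin_entropy_eq:
  assumes "\<omega> \<in> space M"
  shows "plugin_entropy a X n \<omega> = - (\<Sum>i\<in>(\<lambda>k. idx k \<omega>) ` {1..n}. cnt n \<omega> i * (ln (cnt n \<omega> i / n) / n))"
proof -
  let ?S = "(\<lambda>k. idx k \<omega>) ` {1..n}"
  have S: "?S \<subseteq> {1..}" using assms idx_ge_1 by auto
  have zero: "cnt n \<omega> i = 0" if "i \<notin> ?S" for i using that cnt_pos_iff[of n \<omega> i] by simp
  have "plugin_entropy a X n \<omega> = - (\<Sum>\<^sub>\<infinity>i\<in>?S. cnt n \<omega> i / n * ln (cnt n \<omega> i / n))"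
    unfolding plugin_entropy_def shannon_entropy_def empirical_prob_def
  proof (intro arg_cong[where f=uminus] infsum_cong_neutral)
    fix i assume "i \<in> {1..} - ?S"
    then show "letter_count a X n \<omega> i / n * ln (letter_count a X n \<omega> i / n) = 0"
      using zero[of i] cnt_eq[OF assms, of i] by simp
  qed (use S cnt_eq[OF assms] in auto)
  then show ?thesis by simp
qed

text \<open>
  Summing over observations instead of letters gives a fixed finite index set, which makes the
  estimator visibly measurable.
\<close>

lemma miller_madow_eq:
  assumes "\<omega> \<in> space M"
  shows "miller_madow a X n \<omega> = - (\<Sum>k=1..n. ln (cnt n \<omega> (idx k \<omega>) / n) / n)
    + ((\<Sum>k=1..n. 1 / cnt n \<omega> (idx k \<omega>)) - 1) / (2 * n)"
proof -
  let ?S = "(\<lambda>k. idx k \<omega>) ` {1..n}"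
  have "real (card ?S) = (\<Sum>i\<in>?S. cnt n \<omega> i * (1 / cnt n \<omega> i))"
  proof -
    have "(\<Sum>i\<in>?S. cnt n \<omega> i * (1 / cnt n \<omega> i)) = (\<Sum>i\<in>?S. 1)"
      by (intro sum.cong refl) (use cnt_pos_iff[of n \<omega>] in force)
    then show ?thesis by simp
  qed
  then show ?thesis
    unfolding miller_madow_def plugin_entropy_eq[OF assms] distinct_letters_eq[OF assms]
    by (simp only: sum_cnt_mult)
qed

lemma cnt_idx_measurable:
  assumes k: "k \<in> {1..n}"
  shows "(\<lambda>\<omega>. real (cnt n \<omega> (idx k \<omega>))) \<in> borel_measurable M"
proof -
  have "(\<lambda>\<omega>. \<Sum>j=1..n. of_bool (idx j \<omega> = idx k \<omega>) :: real) \<in> borel_measurable M"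
  proof (rule borel_measurable_sum)
    fix j assume j: "j \<in> {1..n}"
    have 1: "idx j \<in> measurable M (count_space UNIV)"
      by (rule idx_measurable) (use j in simp)
    have 2: "idx k \<in> measurable M (count_space UNIV)"
      by (rule idx_measurable) (use k in simp)
    have "(\<lambda>\<omega>. (idx j \<omega>, idx k \<omega>)) \<in> measurable M (count_space UNIV \<Otimes>\<^sub>M count_space UNIV)"
      using 1 2 by (rule measurable_Pair)
    \<comment> \<open>Countability makes the product of the two discrete spaces discrete, so the
      test for equality is measurable.\<close>
    then have "(\<lambda>\<omega>. (idx j \<omega>, idx k \<omega>)) \<in> measurable M (count_space UNIV)"
      by (simp add: pair_measure_countable)
    then show "(\<lambda>\<omega>. of_bool (idx j \<omega> = idx k \<omega>) :: real) \<in> borel_measurable M"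
      by (rule measurable_compose[where g = "\<lambda>(x, y). of_bool (x = y)" and f = "\<lambda>\<omega>. (idx j \<omega>, idx k \<omega>)", simplified]) simp
  qed
  then show ?thesis by (simp add: cnt_def)
qed

lemma miller_madow_measurable: "miller_madow a X n \<in> borel_measurable M"
proof -
  have "(\<lambda>\<omega>. - (\<Sum>k=1..n. ln (cnt n \<omega> (idx k \<omega>) / n) / n)
    + ((\<Sum>k=1..n. 1 / cnt n \<omega> (idx k \<omega>)) - 1) / (2 * n)) \<in> borel_measurable M"
    by (intro borel_measurable_add borel_measurable_uminus borel_measurable_sum borel_measurable_divide
      borel_measurable_ln borel_measurable_diff borel_measurable_const cnt_idx_measurable)
  then show ?thesis using miller_madow_eq by (subst measurable_cong) auto
qed

end

section \<open>Distance between the estimator and the averaged negative log-likelihood\<close>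

context discrete_sample begin

definition log_lik :: "nat \<Rightarrow> 'w \<Rightarrow> real" where
  "log_lik n \<omega> = (\<Sum>k=1..n. - ln (p (idx k \<omega>))) / n"

text \<open>For a cutoff \<open>m\<close>: the chi-square excess \<open>q\<^sup>2 / p - q\<close>
  over letters below \<open>m\<close>, the empirical entropy contribution of the letters from
  \<open>m\<close> on, and the Miller--Madow correction with the number of distinct letters replaced
  by \<open>m\<close> plus the number of observations from \<open>m\<close> on. Each part has an
  explicitly bounded mean.\<close>

definition remainder_bound :: "nat \<Rightarrow> nat \<Rightarrow> 'w \<Rightarrow> real" where
  "remainder_bound n m \<omega> = (\<Sum>i\<in>{1..<m}. (cnt n \<omega> i / n)\<^sup>2 / p i - cnt n \<omega> i / n)
     + (\<Sum>k=1..n. - ln (p (idx k \<omega>)) * indicat_real {m..} (idx k \<omega>)) / n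
     + (real m + (\<Sum>k=1..n. indicat_real {m..} (idx k \<omega>))) / (2 * real n)"

text \<open>The error is minus the divergence \<open>kl\<close> plus the correction. Both quantities
  are nonnegative (at least one letter is observed), so upper bounds for each, added together, bound
  the absolute value.\<close>

lemma abs_miller_madow_minus_log_lik_le:
  assumes \<omega>: "\<omega> \<in> space M" and n: "n \<ge> 1" and pos: "\<forall>k\<in>{1..}. p (idx k \<omega>) > 0"
  shows "\<bar>miller_madow a X n \<omega> - log_lik n \<omega>\<bar> \<le> remainder_bound n m \<omega>"
proof -
  define S where "S = (\<lambda>k. idx k \<omega>) ` {1..n}"
  define q where "q i = cnt n \<omega> i / n" for i
  define kl where "kl = (\<Sum>i\<in>S. q i * (ln (q i) - ln (p i)))"
  have S: "finite S" "S \<subseteq> {1..}" using idx_ge_1 \<omega> by (auto simp: S_def)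
  have q0: "q i = 0" if "i \<notin> S" for i using that cnt_pos_iff[of n \<omega> i] by (simp add: S_def q_def)
  have qpos: "q i > 0" if "i \<in> S" for i using that cnt_pos_iff[of n \<omega> i] n by (simp add: S_def q_def)
  have qle: "q i \<le> 1" for i using cnt_le[of n \<omega> i] n by (simp add: q_def)
  have ppos: "p i > 0" if "i \<in> S" for i using that pos by (auto simp: S_def)
  have sumS: "(\<Sum>i\<in>S. q i * f i) = (\<Sum>k=1..n. f (idx k \<omega>)) / n" for f
  proof -
    have "(\<Sum>i\<in>S. q i * f i) = (\<Sum>i\<in>S. cnt n \<omega> i * (f i / n))" by (simp add: q_def)
    also have "\<dots> = (\<Sum>k=1..n. f (idx k \<omega>) / n)" unfolding S_def by (rule sum_cnt_mult)
    finally show ?thesis by (simp add: sum_divide_distrib)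
  qed
  have card: "distinct_letters a X n \<omega> = card S" using distinct_letters_eq[OF \<omega>] by (simp add: S_def)
  have "idx 1 \<omega> \<in> S" using n by (auto simp: S_def)
  then have card1: "card S \<ge> 1" using S by (metis card_0_eq empty_iff leI less_one)
  have plugin: "plugin_entropy a X n \<omega> = - (\<Sum>i\<in>S. q i * ln (q i))"
    unfolding plugin_entropy_eq[OF \<omega>] by (simp add: S_def q_def)
  have lik: "log_lik n \<omega> = - (\<Sum>i\<in>S. q i * ln (p i))"
    unfolding log_lik_def sumS by (simp add: sum_negf)
  have kl: "plugin_entropy a X n \<omega> - log_lik n \<omega> = - kl"
    unfolding plugin lik kl_def by (simp add: right_diff_distrib sum_subtractf)
  have kl_nonneg: "kl \<ge> 0"
  proof -
    \<comment> \<open>Gibbs' inequality on the observed letters only: there \<open>q\<close> has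
      total mass \<open>1\<close> while \<open>p\<close> has mass at most \<open>1\<close>.\<close>
    have "(\<Sum>i\<in>S. q i - p i) \<le> kl" unfolding kl_def
    proof (rule sum_mono)
      fix i assume i: "i \<in> S"
      have "ln (p i / q i) \<le> p i / q i - 1" using ppos[OF i] qpos[OF i] by (intro ln_le_minus_one) auto
      then have "q i * (ln (p i) - ln (q i)) \<le> q i * (p i / q i - 1)"
        using ppos[OF i] qpos[OF i] by (intro mult_left_mono) (auto simp: ln_div)
      then show "q i - p i \<le> q i * (ln (q i) - ln (p i))" using qpos[OF i] by (simp add: algebra_simps)
    qed
    moreover have "(\<Sum>i\<in>S. q i) = 1" using sumS[of "\<lambda>_. 1"] n by simp
    ultimately show ?thesis using sum_p_le_1[OF S] by (simp add: sum_subtractf)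
  qed
  have kl_le: "kl \<le> (\<Sum>i\<in>{1..<m}. (q i)\<^sup>2 / p i - q i) + (\<Sum>k=1..n. - ln (p (idx k \<omega>)) * indicat_real {m..} (idx k \<omega>)) / n"
  proof -
    have "kl \<le> (\<Sum>i\<in>S. of_bool (i < m) * ((q i)\<^sup>2 / p i - q i) + q i * (- ln (p i) * indicat_real {m..} i))"
      unfolding kl_def
    proof (rule sum_mono)
      fix i assume i: "i \<in> S"
      show "q i * (ln (q i) - ln (p i)) \<le> of_bool (i < m) * ((q i)\<^sup>2 / p i - q i) + q i * (- ln (p i) * indicat_real {m..} i)"
      proof (cases "i < m")
        case True
        have "ln (q i / p i) \<le> q i / p i - 1" using ppos[OF i] qpos[OF i] by (intro ln_le_minus_one) auto
        then have "q i * (ln (q i) - ln (p i)) \<le> q i * (q i / p i - 1)"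
          using ppos[OF i] qpos[OF i] by (intro mult_left_mono) (auto simp: ln_div)
        then show ?thesis using True by (simp add: algebra_simps power2_eq_square)
      next
        case False
        \<comment> \<open>Beyond the cutoff the empirical term is simply dropped, leaving
          \<open>- q i * ln (p i)\<close>.\<close>
        have "q i * ln (q i) \<le> 0" using qpos[OF i] qle[of i] by (intro mult_nonneg_nonpos) auto
        then show ?thesis using False by (simp add: algebra_simps)
      qed
    qed
    also have "\<dots> = (\<Sum>i\<in>S. of_bool (i < m) * ((q i)\<^sup>2 / p i - q i)) + (\<Sum>k=1..n. - ln (p (idx k \<omega>)) * indicat_real {m..} (idx k \<omega>)) / n"
      by (simp only: sum.distrib sumS)
    \<comment> \<open>Letters below \<open>m\<close> that were not observed have
      \<open>q i = 0\<close> and add nothing, so the random index set becomes a fixed one and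
      expectations can be taken termwise.\<close>
    also have "(\<Sum>i\<in>S. of_bool (i < m) * ((q i)\<^sup>2 / p i - q i)) = (\<Sum>i\<in>{1..<m}. (q i)\<^sup>2 / p i - q i)"
      using S q0 by (intro sum.mono_neutral_cong) (auto simp: of_bool_def)
    finally show ?thesis .
  qed
  have card_le: "real (card S) \<le> m + (\<Sum>k=1..n. indicat_real {m..} (idx k \<omega>))"
  proof -
    have "card S \<le> card {..<m} + (\<Sum>k=1..n. if idx k \<omega> \<ge> m then 1 else 0 :: nat)"
    proof -
      have "S \<subseteq> {..<m} \<union> (\<lambda>k. idx k \<omega>) ` {k\<in>{1..n}. idx k \<omega> \<ge> m}" by (auto simp: S_def)
      then have "card S \<le> card ({..<m} \<union> (\<lambda>k. idx k \<omega>) ` {k\<in>{1..n}. idx k \<omega> \<ge> m})" by (intro card_mono) auto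
      also have "\<dots> \<le> card {..<m} + card ((\<lambda>k. idx k \<omega>) ` {k\<in>{1..n}. idx k \<omega> \<ge> m})" by (rule card_Un_le)
      also have "card ((\<lambda>k. idx k \<omega>) ` {k\<in>{1..n}. idx k \<omega> \<ge> m}) \<le> card {k\<in>{1..n}. idx k \<omega> \<ge> m}" by (intro card_image_le) auto
      also have "card {k\<in>{1..n}. idx k \<omega> \<ge> m} = (\<Sum>k=1..n. if idx k \<omega> \<ge> m then 1 else 0)"
        by (simp add: sum.If_cases Int_def)
      finally show ?thesis by simp
    qed
    then have "real (card S) \<le> real (card {..<m}) + real (\<Sum>k=1..n. if idx k \<omega> \<ge> m then 1 else 0)"
      by (simp only: of_nat_le_iff of_nat_add[symmetric])
    also have "real (\<Sum>k=1..n. if idx k \<omega> \<ge> m then 1 else 0) = (\<Sum>k=1..n. indicat_real {m..} (idx k \<omega>))"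
      unfolding of_nat_sum by (intro sum.cong) (auto simp: indicator_def)
    finally show ?thesis by simp
  qed
  have "miller_madow a X n \<omega> - log_lik n \<omega> = - kl + (real (card S) - 1) / (2 * real n)"
    unfolding miller_madow_def card using kl by simp
  moreover have "0 \<le> (real (card S) - 1) / (2 * real n)" using card1 by simp
  moreover have "(real (card S) - 1) / (2 * real n) \<le> (real m + (\<Sum>k=1..n. indicat_real {m..} (idx k \<omega>))) / (2 * real n)"
    using card_le by (intro divide_right_mono) auto
  ultimately show ?thesis using kl_nonneg kl_le unfolding remainder_bound_def q_def by linarith
qed

section \<open>Moments of the counts and the mean of the remainder\<close>

abbreviation hit :: "nat \<Rightarrow> nat \<Rightarrow> 'w \<Rightarrow> real" where
  "hit i k \<omega> \<equiv> of_bool (idx k \<omega> = i)"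

lemma integrable_of_bool_idx: "k \<ge> 1 \<Longrightarrow> integrable M (\<lambda>\<omega>. hit i k \<omega>)"
  by (intro integrable_const_bound[of _ 1] measurable_compose[OF idx_measurable]) auto

lemma expectation_of_bool_idx:
  assumes "k \<ge> 1" "i \<ge> 1"
  shows "expectation (\<lambda>\<omega>. hit i k \<omega>) = p i"
proof -
  have "{\<omega> \<in> space M. idx k \<omega> = i} \<in> events"
    using measurable_sets[OF idx_measurable[OF assms(1)], of "{i}"] by (simp add: vimage_def Int_def conj_commute)
  moreover have "expectation (\<lambda>\<omega>. hit i k \<omega>) = expectation (indicator {\<omega> \<in> space M. idx k \<omega> = i})"
    by (intro Bochner_Integration.integral_cong) (auto simp: indicator_def)
  ultimately show ?thesis using prob_idx[OF assms] by simp
qed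

text \<open>Independence gives \<open>(p i)\<^sup>2\<close> off the diagonal; on it the value is
  \<open>p i\<close>, and allowing the extra \<open>(p i)\<^sup>2\<close> lets one formula cover
  both cases.\<close>

lemma expectation_of_bool_idx_mult:
  assumes "j \<ge> 1" "k \<ge> 1" "i \<ge> 1"
  shows "integrable M (\<lambda>\<omega>. hit i j \<omega> * hit i k \<omega>)"
    and "expectation (\<lambda>\<omega>. hit i j \<omega> * hit i k \<omega>) \<le> (p i)\<^sup>2 + of_bool (j = k) * p i"
proof -
  have meas: "(\<lambda>\<omega>. hit i k \<omega>) \<in> borel_measurable M" if "k \<ge> 1" for k
    using integrable_of_bool_idx[OF that] by (rule borel_measurable_integrable)
  show "integrable M (\<lambda>\<omega>. hit i j \<omega> * hit i k \<omega>)"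
    by (intro integrable_const_bound[of _ 1] borel_measurable_times meas assms) auto
  show "expectation (\<lambda>\<omega>. hit i j \<omega> * hit i k \<omega>) \<le> (p i)\<^sup>2 + of_bool (j = k) * p i"
  proof (cases "j = k")
    case True
    have "expectation (\<lambda>\<omega>. hit i k \<omega> * hit i k \<omega>) = expectation (\<lambda>\<omega>. hit i k \<omega>)"
      by (intro Bochner_Integration.integral_cong) auto
    then show ?thesis using True assms expectation_of_bool_idx by simp
  next
    case False
    have "indep_vars (\<lambda>_. count_space UNIV) idx {j, k}"
      using assms by (intro indep_vars_subset[OF indep_idx]) auto
    then have "indep_vars (\<lambda>_. borel) (\<lambda>k \<omega>. hit i k \<omega>) {j, k}"
      by (rule indep_vars_compose2[where Y = "\<lambda>_ x. of_bool (x = i)"]) auto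
    then have "expectation (\<lambda>\<omega>. \<Prod>l\<in>{j,k}. hit i l \<omega>) = (\<Prod>l\<in>{j,k}. expectation (\<lambda>\<omega>. hit i l \<omega>))"
      using assms integrable_of_bool_idx by (intro indep_vars_lebesgue_integral) auto
    then show ?thesis using False assms by (simp add: expectation_of_bool_idx power2_eq_square)
  qed
qed

text \<open>The second moment of the count is at most
  \<open>n\<^sup>2 * (p i)\<^sup>2 + n * p i\<close>. Dividing by \<open>n\<^sup>2 * p i\<close>
  gives \<open>p i + 1 / n\<close>, and the subtracted mean frequency is \<open>p i\<close>; what
  remains does not depend on the letter.\<close>

lemma expectation_empirical_chi_square:
  assumes n: "n \<ge> 1" and i: "i \<ge> 1"
  shows "integrable M (\<lambda>\<omega>. (cnt n \<omega> i / n)\<^sup>2 / p i - cnt n \<omega> i / n)"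
    and "expectation (\<lambda>\<omega>. (cnt n \<omega> i / n)\<^sup>2 / p i - cnt n \<omega> i / n) \<le> 1 / n"
proof -
  have cnt1: "real (cnt n \<omega> i) = (\<Sum>k=1..n. hit i k \<omega>)" for \<omega> by (simp add: cnt_def)
  have cnt2: "(real (cnt n \<omega> i))\<^sup>2 = (\<Sum>j=1..n. \<Sum>k=1..n. hit i j \<omega> * hit i k \<omega>)" for \<omega>
    unfolding cnt1 power2_eq_square by (rule sum_product)
  have int1: "integrable M (\<lambda>\<omega>. real (cnt n \<omega> i))"
    unfolding cnt1 by (intro Bochner_Integration.integrable_sum integrable_of_bool_idx) auto
  have int2: "integrable M (\<lambda>\<omega>. (real (cnt n \<omega> i))\<^sup>2)"
    unfolding cnt2 using i by (intro Bochner_Integration.integrable_sum expectation_of_bool_idx_mult) auto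
  have E1: "expectation (\<lambda>\<omega>. real (cnt n \<omega> i)) = n * p i"
    unfolding cnt1 using i by (subst Bochner_Integration.integral_sum) (auto intro!: integrable_of_bool_idx simp: expectation_of_bool_idx)
  have "expectation (\<lambda>\<omega>. (real (cnt n \<omega> i))\<^sup>2) = (\<Sum>j=1..n. \<Sum>k=1..n. expectation (\<lambda>\<omega>. hit i j \<omega> * hit i k \<omega>))"
    unfolding cnt2
  proof (subst Bochner_Integration.integral_sum)
    show "integrable M (\<lambda>\<omega>. \<Sum>k=1..n. hit i j \<omega> * hit i k \<omega>)" if "j \<in> {1..n}" for j
      using that i by (intro Bochner_Integration.integrable_sum expectation_of_bool_idx_mult) auto
    show "(\<Sum>j=1..n. expectation (\<lambda>\<omega>. \<Sum>k=1..n. hit i j \<omega> * hit i k \<omega>))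
        = (\<Sum>j=1..n. \<Sum>k=1..n. expectation (\<lambda>\<omega>. hit i j \<omega> * hit i k \<omega>))"
      using i by (intro sum.cong refl Bochner_Integration.integral_sum expectation_of_bool_idx_mult) auto
  qed
  also have "\<dots> \<le> (\<Sum>j=1..n. \<Sum>k=1..n. (p i)\<^sup>2 + of_bool (j = k) * p i)"
    using i by (intro sum_mono expectation_of_bool_idx_mult) auto
  also have "\<dots> = (\<Sum>j=1..n. n * (p i)\<^sup>2 + p i)"
  proof (intro sum.cong refl)
    fix j assume "j \<in> {1..n}"
    then have "(\<Sum>k=1..n. if j = k then p i else 0) = p i" by (simp add: sum.delta)
    moreover have "of_bool (j = k) * p i = (if j = k then p i else 0)" for k by simp
    ultimately show "(\<Sum>k=1..n. (p i)\<^sup>2 + of_bool (j = k) * p i) = n * (p i)\<^sup>2 + p i"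
      by (simp add: sum.distrib)
  qed
  also have "\<dots> = n * (n * (p i)\<^sup>2 + p i)" by simp
  finally have E2: "expectation (\<lambda>\<omega>. (real (cnt n \<omega> i))\<^sup>2) \<le> n * (n * (p i)\<^sup>2 + p i)" .
  show "integrable M (\<lambda>\<omega>. (cnt n \<omega> i / n)\<^sup>2 / p i - cnt n \<omega> i / n)"
    unfolding power_divide by (intro Bochner_Integration.integrable_diff integrable_divide_zero int1 int2)
  have "expectation (\<lambda>\<omega>. (cnt n \<omega> i / n)\<^sup>2 / p i - cnt n \<omega> i / n)
      = expectation (\<lambda>\<omega>. (real (cnt n \<omega> i))\<^sup>2) / (real n)\<^sup>2 / p i - expectation (\<lambda>\<omega>. real (cnt n \<omega> i)) / n"
    unfolding power_divide using int1 int2 by simp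
  also have "\<dots> \<le> 1 / n"
  \<comment> \<open>For a null letter the quotient is \<open>0\<close> by the division convention
    and the mean count vanishes.\<close>
  proof (cases "p i = 0")
    case False
    then have p: "p i > 0" using p_nonneg[OF i] by simp
    have "expectation (\<lambda>\<omega>. (real (cnt n \<omega> i))\<^sup>2) / (real n)\<^sup>2 / p i \<le> n * (n * (p i)\<^sup>2 + p i) / (real n)\<^sup>2 / p i"
      using E2 p by (intro divide_right_mono) auto
    also have "\<dots> = p i + 1 / n" using n p by (simp add: field_simps power2_eq_square)
    finally show ?thesis using n by (simp add: E1)
  qed (use E1 in simp)
  finally show "expectation (\<lambda>\<omega>. (cnt n \<omega> i / n)\<^sup>2 / p i - cnt n \<omega> i / n) \<le> 1 / n" .
qed

text \<open>The letters below \<open>m\<close> contribute at most \<open>m / n\<close> through the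
  chi-square part, and the correction adds \<open>m / (2 * n)\<close>, which together make
  \<open>3 / 2 * m / n\<close>. The tail parts are averages of identically distributed terms, so
  their means are the tail sums, the tail mass being halved by the correction.\<close>

lemma expectation_remainder_bound:
  assumes n: "n \<ge> 1" and int: "integrable M (\<lambda>\<omega>. ln (p (idx 1 \<omega>)))" and m: "m \<ge> 1"
  shows "integrable M (remainder_bound n m)"
    and "expectation (remainder_bound n m) \<le> 3 / 2 * m / n - (\<Sum>\<^sub>\<infinity>i\<in>{m..}. p i * ln (p i)) + (\<Sum>\<^sub>\<infinity>i\<in>{m..}. p i) / 2"
proof -
  let ?f = "\<lambda>i. - ln (p i) * indicat_real {m..} i"
  have f1: "integrable M (\<lambda>\<omega>. ?f (idx 1 \<omega>))"
    by (rule Bochner_Integration.integrable_bound[OF int])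
       (auto intro!: measurable_compose[OF idx_measurable] split: split_indicator)
  have fk: "integrable M (\<lambda>\<omega>. ?f (idx k \<omega>))" if "k \<in> {1..n}" for k
    using that f1 expectation_idx(2)[of k ?f] by simp
  have g1: "integrable M (\<lambda>\<omega>. indicat_real {m..} (idx k \<omega>) :: real)" if "k \<in> {1..n}" for k
    using that by (intro integrable_const_bound[of _ 1] measurable_compose[OF idx_measurable]) auto
  have intA: "integrable M (\<lambda>\<omega>. \<Sum>i\<in>{1..<m}. (cnt n \<omega> i / n)\<^sup>2 / p i - cnt n \<omega> i / n)"
    using n by (intro Bochner_Integration.integrable_sum expectation_empirical_chi_square) auto
  have intB: "integrable M (\<lambda>\<omega>. (\<Sum>k=1..n. ?f (idx k \<omega>)) / n)"
    by (intro integrable_divide_zero Bochner_Integration.integrable_sum fk)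
  have intC': "integrable M (\<lambda>\<omega>. \<Sum>k=1..n. indicat_real {m..} (idx k \<omega>) :: real)"
    by (intro Bochner_Integration.integrable_sum g1)
  have "integrable M (\<lambda>\<omega>. real m + (\<Sum>k=1..n. indicat_real {m..} (idx k \<omega>)))"
    by (rule Bochner_Integration.integrable_add[OF integrable_const intC'])
  then have intC: "integrable M (\<lambda>\<omega>. (real m + (\<Sum>k=1..n. indicat_real {m..} (idx k \<omega>))) / (2 * real n))"
    by (rule integrable_divide_zero)
  show "integrable M (remainder_bound n m)"
    unfolding remainder_bound_def[abs_def] by (intro Bochner_Integration.integrable_add intA intB intC)
  have EA: "expectation (\<lambda>\<omega>. \<Sum>i\<in>{1..<m}. (cnt n \<omega> i / n)\<^sup>2 / p i - cnt n \<omega> i / n) \<le> m / n"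
  proof -
    have "expectation (\<lambda>\<omega>. \<Sum>i\<in>{1..<m}. (cnt n \<omega> i / n)\<^sup>2 / p i - cnt n \<omega> i / n)
        = (\<Sum>i\<in>{1..<m}. expectation (\<lambda>\<omega>. (cnt n \<omega> i / n)\<^sup>2 / p i - cnt n \<omega> i / n))"
      using n by (intro Bochner_Integration.integral_sum expectation_empirical_chi_square) auto
    also have "\<dots> \<le> (\<Sum>i\<in>{1..<m}. 1 / n)"
      using n by (intro sum_mono expectation_empirical_chi_square) auto
    also have "\<dots> \<le> m / n" by (simp add: divide_right_mono)
    finally show ?thesis .
  qed
  have EB: "expectation (\<lambda>\<omega>. (\<Sum>k=1..n. ?f (idx k \<omega>)) / n) = - (\<Sum>\<^sub>\<infinity>i\<in>{m..}. p i * ln (p i))"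
  proof -
    have "expectation (\<lambda>\<omega>. \<Sum>k=1..n. ?f (idx k \<omega>)) = (\<Sum>k=1..n. expectation (\<lambda>\<omega>. ?f (idx k \<omega>)))"
      by (rule Bochner_Integration.integral_sum) (rule fk)
    also have "\<dots> = (\<Sum>k=1..n. expectation (\<lambda>\<omega>. ?f (idx 1 \<omega>)))"
      by (intro sum.cong refl expectation_idx(1)) auto
    also have "\<dots> = n * expectation (\<lambda>\<omega>. ?f (idx 1 \<omega>))" by simp
    also have "expectation (\<lambda>\<omega>. ?f (idx 1 \<omega>)) = - (\<Sum>\<^sub>\<infinity>i\<in>{m..}. p i * ln (p i))"
      using infsum_eq_expectation[OF int, of "{m..}"] m by simp
    finally show ?thesis using n by simp
  qed
  have EC: "expectation (\<lambda>\<omega>. (real m + (\<Sum>k=1..n. indicat_real {m..} (idx k \<omega>))) / (2 * real n)) = m / (2 * real n) + (\<Sum>\<^sub>\<infinity>i\<in>{m..}. p i) / 2"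
  proof -
    have "expectation (\<lambda>\<omega>. \<Sum>k=1..n. indicat_real {m..} (idx k \<omega>)) = (\<Sum>k=1..n. expectation (\<lambda>\<omega>. indicat_real {m..} (idx k \<omega>)))"
      by (rule Bochner_Integration.integral_sum) (rule g1)
    also have "\<dots> = (\<Sum>k=1..n. expectation (\<lambda>\<omega>. indicat_real {m..} (idx 1 \<omega>)))"
      by (intro sum.cong refl expectation_idx(1)) auto
    also have "\<dots> = n * expectation (\<lambda>\<omega>. indicat_real {m..} (idx 1 \<omega>))" by simp
    also have "expectation (\<lambda>\<omega>. indicat_real {m..} (idx 1 \<omega>)) = (\<Sum>\<^sub>\<infinity>i\<in>{m..}. p i)"
      using infsum_eq_expectation[of "\<lambda>_. 1" "{m..}"] m by simp
    finally have 1: "expectation (\<lambda>\<omega>. \<Sum>k=1..n. indicat_real {m..} (idx k \<omega>)) = n * (\<Sum>\<^sub>\<infinity>i\<in>{m..}. p i)" .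
    have "expectation (\<lambda>\<omega>. (real m + (\<Sum>k=1..n. indicat_real {m..} (idx k \<omega>))) / (2 * real n))
        = (real m + expectation (\<lambda>\<omega>. \<Sum>k=1..n. indicat_real {m..} (idx k \<omega>))) / (2 * real n)"
      using intC' prob_space by (simp add: Bochner_Integration.integral_add del: Bochner_Integration.integral_sum)
    then show ?thesis unfolding 1 using n by (simp add: field_simps)
  qed
  have "expectation (remainder_bound n m) = expectation (\<lambda>\<omega>. \<Sum>i\<in>{1..<m}. (cnt n \<omega> i / n)\<^sup>2 / p i - cnt n \<omega> i / n)
     + expectation (\<lambda>\<omega>. (\<Sum>k=1..n. ?f (idx k \<omega>)) / n)
     + expectation (\<lambda>\<omega>. (real m + (\<Sum>k=1..n. indicat_real {m..} (idx k \<omega>))) / (2 * real n))"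
    unfolding remainder_bound_def[abs_def]
    by (subst Bochner_Integration.integral_add[OF Bochner_Integration.integrable_add[OF intA intB] intC],
        subst Bochner_Integration.integral_add[OF intA intB]) (rule refl)
  also have "\<dots> \<le> m / n - (\<Sum>\<^sub>\<infinity>i\<in>{m..}. p i * ln (p i)) + (m / (2 * real n) + (\<Sum>\<^sub>\<infinity>i\<in>{m..}. p i) / 2)"
    unfolding EB EC using EA by simp
  also have "\<dots> = 3 / 2 * m / n - (\<Sum>\<^sub>\<infinity>i\<in>{m..}. p i * ln (p i)) + (\<Sum>\<^sub>\<infinity>i\<in>{m..}. p i) / 2"
    using n by (simp add: field_simps)
  finally show "expectation (remainder_bound n m) \<le> 3 / 2 * m / n - (\<Sum>\<^sub>\<infinity>i\<in>{m..}. p i * ln (p i)) + (\<Sum>\<^sub>\<infinity>i\<in>{m..}. p i) / 2" .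
qed

lemma log_lik_measurable: "log_lik n \<in> borel_measurable M"
  unfolding log_lik_def[abs_def]
  by (intro borel_measurable_divide borel_measurable_sum measurable_compose[OF idx_measurable]) auto

lemma expectation_abs_remainder:
  assumes n: "n \<ge> 1" and int: "integrable M (\<lambda>\<omega>. ln (p (idx 1 \<omega>)))" and m: "m \<ge> 1"
  shows "integrable M (\<lambda>\<omega>. \<bar>miller_madow a X n \<omega> - log_lik n \<omega>\<bar>)"
    and "expectation (\<lambda>\<omega>. \<bar>miller_madow a X n \<omega> - log_lik n \<omega>\<bar>)
      \<le> 3 / 2 * m / n - (\<Sum>\<^sub>\<infinity>i\<in>{m..}. p i * ln (p i)) + (\<Sum>\<^sub>\<infinity>i\<in>{m..}. p i) / 2"
proof -
  note U = expectation_remainder_bound[OF assms]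
  have AE: "AE \<omega> in M. \<bar>miller_madow a X n \<omega> - log_lik n \<omega>\<bar> \<le> remainder_bound n m \<omega>"
    using AE_p_idx_pos by (rule AE_mp) (auto intro!: AE_I2 abs_miller_madow_minus_log_lik_le n)
  show int: "integrable M (\<lambda>\<omega>. \<bar>miller_madow a X n \<omega> - log_lik n \<omega>\<bar>)"
  proof (rule Bochner_Integration.integrable_bound[OF U(1)])
    show "(\<lambda>\<omega>. \<bar>miller_madow a X n \<omega> - log_lik n \<omega>\<bar>) \<in> borel_measurable M"
      by (intro borel_measurable_abs borel_measurable_diff miller_madow_measurable log_lik_measurable)
    show "AE \<omega> in M. norm \<bar>miller_madow a X n \<omega> - log_lik n \<omega>\<bar> \<le> norm (remainder_bound n m \<omega>)"
      using AE by eventually_elim simp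
  qed
  show "expectation (\<lambda>\<omega>. \<bar>miller_madow a X n \<omega> - log_lik n \<omega>\<bar>)
      \<le> 3 / 2 * m / n - (\<Sum>\<^sub>\<infinity>i\<in>{m..}. p i * ln (p i)) + (\<Sum>\<^sub>\<infinity>i\<in>{m..}. p i) / 2"
    using integral_mono_AE[OF int U(1) AE] U(2) by linarith
qed

end

subsection \<open>Normal approximation of the estimator\<close>

text \<open>Off the event \<open>\<bar>S - T\<bar> \<ge> \<epsilon>\<close>, \<open>S < x\<close>
  forces \<open>T \<le> x + \<epsilon>\<close>, and \<open>T \<le> x - \<epsilon>\<close> forces
  \<open>S < x\<close>. The strict closeness there reconciles the strict inequality for
  \<open>S\<close> with the closed half-lines of \<open>cdf\<close>; moving the normal distribution
  function by \<open>\<epsilon>\<close> costs at most \<open>\<epsilon>\<close>.\<close>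

lemma (in prob_space) prob_less_perturbed_le:
  fixes S T :: "'a \<Rightarrow> real"
  assumes [measurable]: "random_variable borel S" "random_variable borel T"
    and A: "\<And>x. \<bar>cdf (distr M borel T) x - cdf std_normal_distribution x\<bar> \<le> A"
    and B: "prob {\<omega> \<in> space M. \<bar>S \<omega> - T \<omega>\<bar> \<ge> \<epsilon>} \<le> B" and \<epsilon>: "\<epsilon> \<ge> 0"
  shows "\<bar>prob {\<omega> \<in> space M. S \<omega> < x} - cdf std_normal_distribution x\<bar> \<le> A + \<epsilon> + B"
proof -
  have cdfT: "cdf (distr M borel T) y = prob {\<omega> \<in> space M. T \<omega> \<le> y}" for y
    unfolding cdf_def by (subst measure_distr) (auto intro!: arg_cong[where f=prob])
  have lip: "cdf std_normal_distribution (y + \<epsilon>) - cdf std_normal_distribution y \<le> \<epsilon>" for y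
    using std_normal_cdf_lipschitz[of y "y + \<epsilon>"] \<epsilon> by simp
  have "prob {\<omega> \<in> space M. S \<omega> < x} \<le> prob ({\<omega> \<in> space M. T \<omega> \<le> x + \<epsilon>} \<union> {\<omega> \<in> space M. \<bar>S \<omega> - T \<omega>\<bar> \<ge> \<epsilon>})"
    by (intro finite_measure_mono) auto
  also have "\<dots> \<le> prob {\<omega> \<in> space M. T \<omega> \<le> x + \<epsilon>} + prob {\<omega> \<in> space M. \<bar>S \<omega> - T \<omega>\<bar> \<ge> \<epsilon>}"
    by (intro measure_Un_le) auto
  finally have upper: "prob {\<omega> \<in> space M. S \<omega> < x} \<le> cdf std_normal_distribution x + A + \<epsilon> + B"
    using A[of "x + \<epsilon>"] B lip[of x] unfolding cdfT by linarith
  have "prob {\<omega> \<in> space M. T \<omega> \<le> x - \<epsilon>} \<le> prob ({\<omega> \<in> space M. S \<omega> < x} \<union> {\<omega> \<in> space M. \<bar>S \<omega> - T \<omega>\<bar> \<ge> \<epsilon>})"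
    by (intro finite_measure_mono) auto
  also have "\<dots> \<le> prob {\<omega> \<in> space M. S \<omega> < x} + prob {\<omega> \<in> space M. \<bar>S \<omega> - T \<omega>\<bar> \<ge> \<epsilon>}"
    by (intro measure_Un_le) auto
  finally have lower: "prob {\<omega> \<in> space M. S \<omega> < x} \<ge> cdf std_normal_distribution x - A - \<epsilon> - B"
    using A[of "x - \<epsilon>"] B lip[of "x - \<epsilon>"] unfolding cdfT by simp
  show ?thesis using upper lower by linarith
qed

text \<open>Carries the moment assumption on \<open>ln p(X_1)\<close> over to the centred variable,
  using that a sum is at most twice the larger term.\<close>

lemma (in prob_space) integrable_powr_add_const:
  fixes f :: "'a \<Rightarrow> real"
  assumes f: "f \<in> borel_measurable M" and int: "integrable M (\<lambda>\<omega>. \<bar>f \<omega>\<bar> powr r)" and r: "r \<ge> 0"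
  shows "integrable M (\<lambda>\<omega>. \<bar>f \<omega> + c\<bar> powr r)"
proof (rule Bochner_Integration.integrable_bound)
  show "integrable M (\<lambda>\<omega>. 2 powr r * (\<bar>f \<omega>\<bar> powr r + \<bar>c\<bar> powr r))" using int by simp
  show "(\<lambda>\<omega>. \<bar>f \<omega> + c\<bar> powr r) \<in> borel_measurable M" using f by measurable
  have "\<bar>x + c\<bar> powr r \<le> 2 powr r * (\<bar>x\<bar> powr r + \<bar>c\<bar> powr r)" for x
  proof -
    have "\<bar>x + c\<bar> powr r \<le> (2 * max \<bar>x\<bar> \<bar>c\<bar>) powr r" using r by (intro powr_mono2) auto
    also have "\<dots> = 2 powr r * (max \<bar>x\<bar> \<bar>c\<bar>) powr r" by (simp add: powr_mult)
    also have "\<dots> \<le> 2 powr r * (\<bar>x\<bar> powr r + \<bar>c\<bar> powr r)" by (intro mult_left_mono) (auto simp: max_def)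
    finally show ?thesis .
  qed
  then show "AE \<omega> in M. norm (\<bar>f \<omega> + c\<bar> powr r) \<le> norm (2 powr r * (\<bar>f \<omega>\<bar> powr r + \<bar>c\<bar> powr r))"
    by auto
qed

text \<open>On \<open>[-1, 1]\<close> the power is at most \<open>1\<close>, outside it is at most
  the \<open>r\<close>-th one. Applied with \<open>k = 1\<close> to get the mean of
  \<open>ln p(X_1)\<close>.\<close>

lemma (in prob_space) integrable_power_of_integrable_powr:
  fixes f :: "'a \<Rightarrow> real"
  assumes f: "f \<in> borel_measurable M" and int: "integrable M (\<lambda>\<omega>. \<bar>f \<omega>\<bar> powr r)" and k: "real k \<le> r"
  shows "integrable M (\<lambda>\<omega>. f \<omega> ^ k)"
proof (rule Bochner_Integration.integrable_bound)
  show "integrable M (\<lambda>\<omega>. 1 + \<bar>f \<omega>\<bar> powr r)" using int by simp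
  show "(\<lambda>\<omega>. f \<omega> ^ k) \<in> borel_measurable M" using f by measurable
  have "\<bar>x\<bar> ^ k \<le> 1 + \<bar>x\<bar> powr r" for x
  proof (cases "\<bar>x\<bar> \<le> 1")
    case True
    then have "\<bar>x\<bar> ^ k \<le> 1" by (simp add: power_le_one)
    then show ?thesis using powr_ge_zero[of "\<bar>x\<bar>" r] by linarith
  next
    case False
    then have "\<bar>x\<bar> ^ k = \<bar>x\<bar> powr k" by (intro powr_realpow[symmetric]) auto
    also have "\<dots> \<le> \<bar>x\<bar> powr r" using False k by (intro powr_mono) auto
    finally show ?thesis by simp
  qed
  then show "AE \<omega> in M. norm (f \<omega> ^ k) \<le> norm (1 + \<bar>f \<omega>\<bar> powr r)"
    by (auto simp: power_abs abs_of_nonneg add_nonneg_nonneg)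
qed

context discrete_sample begin

lemma prob_remainder_le:
  assumes n: "n \<ge> 1" and int: "integrable M (\<lambda>\<omega>. ln (p (idx 1 \<omega>)))" and m: "m \<ge> 1"
    and \<delta>: "0 < \<delta>" "\<delta> < 1 / 2" and \<sigma>: "\<sigma> > 0"
    and m_le: "real m \<le> real n powr (1 / 2 - \<delta>)"
    and tail: "real n powr (1 / 2 + \<delta>) * ln (real n) * (\<Sum>\<^sub>\<infinity>i\<in>{m..}. p i) \<le> C\<^sub>0"
    and entropy_tail: "- (real n powr (1 / 2 + \<delta>)) * (\<Sum>\<^sub>\<infinity>i\<in>{m..}. p i * ln (p i)) \<le> C\<^sub>0"
  shows "prob {\<omega> \<in> space M. \<bar>sqrt n * (miller_madow a X n \<omega> - H) / \<sigma> - sqrt n * (log_lik n \<omega> - H) / \<sigma>\<bar> \<ge> real n powr (- \<delta> / 2)}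
    \<le> (5 / 2 + 3 / 2 * \<bar>C\<^sub>0\<bar>) / \<sigma> * real n powr (- \<delta> / 2)"
proof -
  define r where "r = real n powr (1 / 2 + \<delta>)"
  define t where "t = (\<Sum>\<^sub>\<infinity>i\<in>{m..}. p i)"
  define R where "R \<omega> = \<bar>miller_madow a X n \<omega> - log_lik n \<omega>\<bar>" for \<omega>
  have r: "r > 0" using n by (simp add: r_def)
  have t01: "0 \<le> t" "t \<le> 1"
  proof -
    show "0 \<le> t" unfolding t_def using m p_nonneg by (intro infsum_nonneg) auto
    have "t = expectation (\<lambda>\<omega>. indicat_real {m..} (idx 1 \<omega>))"
      using infsum_eq_expectation[of "\<lambda>_. 1" "{m..}"] m by (simp add: t_def)
    also have "\<dots> \<le> expectation (\<lambda>\<omega>. 1)"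
      by (intro integral_mono integrable_const_bound[of _ 1] measurable_compose[OF idx_measurable])
         (auto split: split_indicator)
    finally show "t \<le> 1" using prob_space by simp
  qed
  \<comment> \<open>From \<open>n = 3\<close> on, \<open>ln n \<ge> 1\<close> and
    \<open>tail\<close> applies. For \<open>n = 1, 2\<close> the logarithm is too small, but then
    \<open>r \<le> n \<le> 2\<close> and \<open>t \<le> 1\<close>; this is the origin of the summand
    \<open>2\<close>.\<close>
  have "r * t \<le> \<bar>C\<^sub>0\<bar> + 2"
  proof (cases "n \<ge> 3")
    case True
    have "exp 1 \<le> (3 :: real)" by (rule exp_le)
    also have "\<dots> \<le> n" using True by simp
    finally have "1 \<le> ln (real n)" using n by (subst ln_ge_iff) auto
    then have "r * t * 1 \<le> r * t * ln (real n)" using r t01 by (intro mult_left_mono) auto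
    then show ?thesis using tail by (simp add: r_def t_def mult_ac)
  next
    case False
    have "r \<le> real n powr 1" unfolding r_def using n \<delta> by (intro powr_mono) auto
    then have "r \<le> 2" using False n by simp
    then have "r * t \<le> 2 * 1" using t01 r by (intro mult_mono) auto
    then show ?thesis by simp
  qed
  then have t: "t \<le> (\<bar>C\<^sub>0\<bar> + 2) / r" using r by (simp add: field_simps)
  have e: "- (\<Sum>\<^sub>\<infinity>i\<in>{m..}. p i * ln (p i)) \<le> \<bar>C\<^sub>0\<bar> / r"
  proof -
    have "r * - (\<Sum>\<^sub>\<infinity>i\<in>{m..}. p i * ln (p i)) \<le> \<bar>C\<^sub>0\<bar>"
      using entropy_tail by (simp add: r_def)
    then show ?thesis using r by (simp add: field_simps)
  qed
  have m_r: "m / n \<le> 1 / r"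
  proof -
    have "real m * r \<le> real n powr (1 / 2 - \<delta>) * r" using r by (intro mult_right_mono m_le) auto
    also have "\<dots> = n" using n by (simp add: r_def powr_add[symmetric])
    finally show ?thesis using r n by (simp add: field_simps)
  qed
  have "expectation R \<le> 3 / 2 * m / n - (\<Sum>\<^sub>\<infinity>i\<in>{m..}. p i * ln (p i)) + t / 2"
    unfolding R_def t_def by (rule expectation_abs_remainder[OF n int m])
  \<comment> \<open>All three contributions are of the common order \<open>1 / r\<close>. The
    numerators \<open>3 / 2\<close>, \<open>\<bar>C\<^sub>0\<bar>\<close> and
    \<open>(\<bar>C\<^sub>0\<bar> + 2) / 2\<close> add up to the stated constant.\<close>
  also have "\<dots> \<le> 3 / 2 * (1 / r) + \<bar>C\<^sub>0\<bar> / r + (\<bar>C\<^sub>0\<bar> + 2) / r / 2"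
    using m_r e t by simp
  also have "\<dots> = (5 / 2 + 3 / 2 * \<bar>C\<^sub>0\<bar>) / r" using r by (simp add: field_simps)
  finally have ER: "expectation R \<le> (5 / 2 + 3 / 2 * \<bar>C\<^sub>0\<bar>) / r" .
  \<comment> \<open>The level \<open>n powr (- \<delta> / 2)\<close> translated back to the unscaled
    remainder. In \<open>1 / (r * c)\<close> the exponents \<open>- 1 / 2 - \<delta>\<close>,
    \<open>\<delta> / 2\<close> and \<open>1 / 2\<close> combine to
    \<open>- \<delta> / 2\<close>.\<close>
  define c where "c = real n powr (- \<delta> / 2) * \<sigma> / sqrt n"
  have c: "c > 0" using n \<sigma> by (simp add: c_def)
  have "prob {\<omega> \<in> space M. \<bar>sqrt n * (miller_madow a X n \<omega> - H) / \<sigma> - sqrt n * (log_lik n \<omega> - H) / \<sigma>\<bar> \<ge> real n powr (- \<delta> / 2)}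
      = prob {\<omega> \<in> space M. R \<omega> \<ge> c}"
  proof (intro arg_cong[where f=prob] Collect_cong conj_cong refl)
    fix \<omega>
    have "sqrt n * (miller_madow a X n \<omega> - H) / \<sigma> - sqrt n * (log_lik n \<omega> - H) / \<sigma>
        = sqrt n / \<sigma> * (miller_madow a X n \<omega> - log_lik n \<omega>)" by (simp add: algebra_simps diff_divide_distrib)
    then have "\<bar>sqrt n * (miller_madow a X n \<omega> - H) / \<sigma> - sqrt n * (log_lik n \<omega> - H) / \<sigma>\<bar> = sqrt n / \<sigma> * R \<omega>"
      using \<sigma> by (simp add: R_def abs_mult)
    then show "real n powr (- \<delta> / 2) \<le> \<bar>sqrt n * (miller_madow a X n \<omega> - H) / \<sigma> - sqrt n * (log_lik n \<omega> - H) / \<sigma>\<bar> \<longleftrightarrow> c \<le> R \<omega>"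
      using n \<sigma> by (simp add: c_def field_simps)
  qed
  also have "\<dots> \<le> expectation R / c"
    using expectation_abs_remainder(1)[OF n int m] c
    by (intro integral_Markov_inequality_measure[of _ _ "{}"]) (auto simp: R_def)
  also have "\<dots> \<le> (5 / 2 + 3 / 2 * \<bar>C\<^sub>0\<bar>) / r / c" using ER c by (intro divide_right_mono) auto
  also have "\<dots> = (5 / 2 + 3 / 2 * \<bar>C\<^sub>0\<bar>) / \<sigma> * (1 / (r * real n powr (- \<delta> / 2) * real n powr (- 1 / 2)))"
  proof -
    have "sqrt n = 1 / real n powr (- 1 / 2)"
      using n powr_minus_divide[of "real n" "1 / 2"] by (simp add: powr_half_sqrt)
    then show ?thesis by (simp add: c_def)
  qed
  also have "1 / (r * real n powr (- \<delta> / 2) * real n powr (- 1 / 2)) = real n powr (- \<delta> / 2)"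
    using n by (simp add: r_def powr_add[symmetric] powr_minus_divide[symmetric])
  finally show ?thesis .
qed

lemma miller_madow_berry_esseen:
  fixes K :: "nat \<Rightarrow> nat" and \<delta> C\<^sub>0 \<sigma> :: real
  assumes \<delta>: "0 < \<delta>" "\<delta> < 1 / 2"
    and moment: "integrable M (\<lambda>\<omega>. \<bar>ln (p (idx 1 \<omega>))\<bar> powr (2 + \<delta>))"
    and K: "\<And>n. n \<ge> 1 \<Longrightarrow> K n \<ge> 1" "\<And>n. n \<ge> 1 \<Longrightarrow> real (K n) \<le> real n powr (1 / 2 - \<delta>)"
    and tail: "\<And>n. n \<ge> 1 \<Longrightarrow> real n powr (1 / 2 + \<delta>) * ln (real n) * (\<Sum>\<^sub>\<infinity>i\<in>{K n..}. p i) \<le> C\<^sub>0"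
    and entropy_tail: "\<And>n. n \<ge> 1 \<Longrightarrow> - (real n powr (1 / 2 + \<delta>)) * (\<Sum>\<^sub>\<infinity>i\<in>{K n..}. p i * ln (p i)) \<le> C\<^sub>0"
    and \<sigma>: "\<sigma>\<^sup>2 = variance (\<lambda>\<omega>. ln (p (idx 1 \<omega>)))" "\<sigma> > 0"
  obtains C where "C > 0"
    "\<And>n x. n \<ge> 1 \<Longrightarrow> \<bar>prob {\<omega> \<in> space M. sqrt n * (miller_madow a X n \<omega> - shannon_entropy p) / \<sigma> < x}
       - cdf std_normal_distribution x\<bar> \<le> C * real n powr (- \<delta> / 2)"
proof -
  define H where "H = shannon_entropy p"
  have meas: "(\<lambda>\<omega>. f (idx k \<omega>)) \<in> borel_measurable M" if "k \<ge> 1" for k and f :: "nat \<Rightarrow> real"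
    by (rule measurable_compose[OF idx_measurable[OF that]]) simp
  have int: "integrable M (\<lambda>\<omega>. ln (p (idx 1 \<omega>)))"
    using integrable_power_of_integrable_powr[OF meas[of 1 "\<lambda>i. ln (p i)"] moment, of 1] \<delta> by simp
  have H: "H = - expectation (\<lambda>\<omega>. ln (p (idx 1 \<omega>)))"
  proof -
    have "(\<Sum>\<^sub>\<infinity>i\<in>{1..}. p i * ln (p i)) = expectation (\<lambda>\<omega>. ln (p (idx 1 \<omega>)) * indicator {1..} (idx 1 \<omega>))"
      by (rule infsum_eq_expectation[OF int]) simp
    also have "\<dots> = expectation (\<lambda>\<omega>. ln (p (idx 1 \<omega>)))"
      by (intro Bochner_Integration.integral_cong) (auto simp: idx_ge_1)
    finally show ?thesis by (simp add: H_def shannon_entropy_def)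
  qed
  \<comment> \<open>Standardised negative log-probability: \<open>H\<close> is the mean of
    \<open>- ln p(X_1)\<close>, which explains the sign, and \<open>\<sigma>\<close> is its standard
    deviation.\<close>
  define z where "z i = (- ln (p i) - H) / \<sigma>" for i
  have z: "z i = (ln (p i) + H) * (- 1 / \<sigma>)" for i using \<sigma> by (simp add: z_def field_simps)
  have indep: "indep_vars (\<lambda>_. borel) (\<lambda>k \<omega>. z (idx k \<omega>)) {1..}"
    by (rule indep_vars_compose2[OF indep_idx]) auto
  have distr: "distr M borel (\<lambda>\<omega>. z (idx k \<omega>)) = distr M borel (\<lambda>\<omega>. z (idx 1 \<omega>))" if "k \<ge> 1" for k
  proof -
    have "distr M borel (\<lambda>\<omega>. z (idx j \<omega>)) = distr (distr M (count_space UNIV) (idx j)) borel z" if "j \<ge> 1" for j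
      using that by (subst distr_distr) (auto simp: comp_def)
    then show ?thesis using distr_idx[OF that] that by simp
  qed
  have mean: "expectation (\<lambda>\<omega>. z (idx 1 \<omega>)) = 0"
    unfolding z using int prob_space by (simp add: H)
  have var: "expectation (\<lambda>\<omega>. (z (idx 1 \<omega>))\<^sup>2) = 1"
  proof -
    have "expectation (\<lambda>\<omega>. (z (idx 1 \<omega>))\<^sup>2) = expectation (\<lambda>\<omega>. (ln (p (idx 1 \<omega>)) - expectation (\<lambda>\<omega>. ln (p (idx 1 \<omega>))))\<^sup>2 / \<sigma>\<^sup>2)"
      unfolding z H by (simp add: power_mult_distrib power_divide)
    also have "\<dots> = \<sigma>\<^sup>2 / \<sigma>\<^sup>2" unfolding \<sigma>(1) by simp
    finally show ?thesis using \<sigma>(2) by simp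
  qed
  have zmom: "integrable M (\<lambda>\<omega>. \<bar>z (idx 1 \<omega>)\<bar> powr (2 + \<delta>))"
  proof -
    have "integrable M (\<lambda>\<omega>. \<bar>ln (p (idx 1 \<omega>)) + H\<bar> powr (2 + \<delta>))"
      by (rule integrable_powr_add_const[OF meas[of 1 "\<lambda>i. ln (p i)"] moment]) (use \<delta> in auto)
    then have "integrable M (\<lambda>\<omega>. \<bar>ln (p (idx 1 \<omega>)) + H\<bar> powr (2 + \<delta>) * (1 / \<sigma>) powr (2 + \<delta>))"
      by (rule integrable_mult_left)
    moreover have "\<bar>z i\<bar> powr (2 + \<delta>) = \<bar>ln (p i) + H\<bar> powr (2 + \<delta>) * (1 / \<sigma>) powr (2 + \<delta>)" for i
    proof -
      have "\<bar>z i\<bar> = \<bar>ln (p i) + H\<bar> * (1 / \<sigma>)" using \<sigma>(2) by (simp add: z abs_mult)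
      then show ?thesis using \<sigma>(2) by (simp only: powr_mult abs_ge_zero zero_le_divide_1_iff less_imp_le)
    qed
    ultimately show ?thesis by simp
  qed
  obtain C where C: "C > 0" and be: "\<And>n x. n \<ge> 1 \<Longrightarrow>
      \<bar>cdf (distr M borel (\<lambda>\<omega>. (\<Sum>k=1..n. z (idx k \<omega>)) / sqrt n)) x - cdf std_normal_distribution x\<bar> \<le> C * real n powr (- \<delta> / 2)"
    by (rule berry_esseen[OF \<delta>(1) _ indep distr mean var zmom]) (use \<delta>(2) in simp, assumption, rule that)
  have sum_z: "(\<Sum>k=1..n. z (idx k \<omega>)) / sqrt n = sqrt n * (log_lik n \<omega> - H) / \<sigma>" if n: "n \<ge> 1" for n \<omega>
  proof -
    have "(\<Sum>k=1..n. z (idx k \<omega>)) = n * (log_lik n \<omega> - H) / \<sigma>"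
      unfolding z_def log_lik_def sum_divide_distrib[symmetric] sum_subtractf using n by (simp add: right_diff_distrib)
    also have "\<dots> = sqrt n * (sqrt n * (log_lik n \<omega> - H) / \<sigma>)" by simp
    finally show ?thesis using n by simp
  qed
  define D where "D = (5 / 2 + 3 / 2 * \<bar>C\<^sub>0\<bar>) / \<sigma>"
  show ?thesis
  \<comment> \<open>The three summands are the Berry--Esseen error of the log-likelihood average,
    the shift \<open>\<epsilon> = n powr (- \<delta> / 2)\<close> of the normal distribution
    function, and the Markov bound for the remainder.\<close>
  proof (rule that[of "C + 1 + D"])
    show "C + 1 + D > 0" using C \<sigma> by (intro add_pos_nonneg) (auto simp: D_def)
    fix n :: nat and x :: real assume n: "n \<ge> 1"
    have "\<bar>prob {\<omega> \<in> space M. sqrt n * (miller_madow a X n \<omega> - H) / \<sigma> < x} - cdf std_normal_distribution x\<bar>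
       \<le> C * real n powr (- \<delta> / 2) + real n powr (- \<delta> / 2) + D * real n powr (- \<delta> / 2)"
    proof (rule prob_less_perturbed_le)
      show "(\<lambda>\<omega>. sqrt n * (miller_madow a X n \<omega> - H) / \<sigma>) \<in> borel_measurable M"
        by (intro borel_measurable_divide borel_measurable_times borel_measurable_diff borel_measurable_const miller_madow_measurable)
      show "(\<lambda>\<omega>. sqrt n * (log_lik n \<omega> - H) / \<sigma>) \<in> borel_measurable M"
        by (intro borel_measurable_divide borel_measurable_times borel_measurable_diff borel_measurable_const log_lik_measurable)
      show "\<bar>cdf (distr M borel (\<lambda>\<omega>. sqrt n * (log_lik n \<omega> - H) / \<sigma>)) x - cdf std_normal_distribution x\<bar> \<le> C * real n powr (- \<delta> / 2)" for x
        using be[OF n, of x] unfolding sum_z[OF n] .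
      show "prob {\<omega> \<in> space M. real n powr (- \<delta> / 2) \<le> \<bar>sqrt n * (miller_madow a X n \<omega> - H) / \<sigma> - sqrt n * (log_lik n \<omega> - H) / \<sigma>\<bar>}
          \<le> D * real n powr (- \<delta> / 2)"
        unfolding D_def using n by (intro prob_remainder_le[where m = "K n"] int \<delta> \<sigma> K tail entropy_tail)
    qed simp
    then show "\<bar>prob {\<omega> \<in> space M. sqrt n * (miller_madow a X n \<omega> - shannon_entropy p) / \<sigma> < x}
       - cdf std_normal_distribution x\<bar> \<le> (C + 1 + D) * real n powr (- \<delta> / 2)"
      by (simp add: H_def algebra_simps)
  qed
qed

end

theorem theorem3p2:
  fixes M :: "'w measure" and a :: "nat \<Rightarrow> 'a" and A :: "'a set"
    and X :: "nat \<Rightarrow> 'w \<Rightarrow> 'a" and p :: "nat \<Rightarrow> real"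
    and K :: "nat \<Rightarrow> nat" and \<delta> C\<^sub>0 H \<sigma> :: real
  assumes "prob_space M"
    and "inj_on a {1..}" and "A = a ` {1..}"
    and "prob_space.indep_vars M (\<lambda>_. count_space A) X {1..}"
    and "\<And>n. n \<ge> 1 \<Longrightarrow> distr M (count_space A) (X n) = distr M (count_space A) (X 1)"
    and "\<And>i. i \<ge> 1 \<Longrightarrow> p i = letter_prob M (X 1) (a i)"
    and "nonuniform p"
    and "0 < \<delta>" and "\<delta> < 1 / 2"
    and "integrable M (\<lambda>\<omega>. \<bar>ln (letter_prob M (X 1) (X 1 \<omega>))\<bar> powr (2 + \<delta>))"
    and "\<And>n. n \<ge> 1 \<Longrightarrow> K n \<ge> 1"
    and "\<And>n. n \<ge> 1 \<Longrightarrow> real (K n) \<le> real n powr (1 / 2 - \<delta>)"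
    and "\<And>n. n \<ge> 1 \<Longrightarrow>
           real n powr (1 / 2 + \<delta>) * ln (real n) * (\<Sum>\<^sub>\<infinity>i\<in>{K n..}. p i) \<le> C\<^sub>0"
    and "\<And>n. n \<ge> 1 \<Longrightarrow>
           - (real n powr (1 / 2 + \<delta>)) * (\<Sum>\<^sub>\<infinity>i\<in>{K n..}. p i * ln (p i)) \<le> C\<^sub>0"
    and "H = shannon_entropy p"
    and "\<sigma>\<^sup>2 = prob_space.variance M (\<lambda>\<omega>. ln (letter_prob M (X 1) (X 1 \<omega>)))"
    and "\<sigma> > 0"
  shows "\<exists>C>0. \<forall>n\<ge>1.
    (SUP x. \<bar>measure M {\<omega> \<in> space M. sqrt (real n) * (miller_madow a X n \<omega> - H) / \<sigma> < x}
             - cdf std_normal_distribution x\<bar>)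
      \<le> C * real n powr (- \<delta> / 2)"
proof -
  interpret prob_space M by fact
  interpret discrete_sample M a X p
  proof unfold_locales
    show "inj_on a {1..}" by fact
    show "indep_vars (\<lambda>_. count_space (a ` {1..})) X {1..}"
      using assms(4) unfolding assms(3) .
    show "distr M (count_space (a ` {1..})) (X n) = distr M (count_space (a ` {1..})) (X 1)" if "n \<ge> 1" for n
      using assms(5)[OF that] unfolding assms(3) .
    show "p i = letter_prob M (X 1) (a i)" if "i \<ge> 1" for i
      using that by (rule assms(6))
  qed
  \<comment> \<open>On \<open>space M\<close> the value
    \<open>letter_prob M (X 1) (X 1 \<omega>)\<close> is \<open>p (idx 1 \<omega>)\<close>, so
    moments and variance pass to the index sample.\<close>
  have moment: "integrable M (\<lambda>\<omega>. \<bar>ln (p (idx 1 \<omega>))\<bar> powr (2 + \<delta>))"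
    using assms(10) by (rule Bochner_Integration.integrable_cong[THEN iffD1, rotated 2]) (auto simp: letter_prob_X)
  have expectation: "expectation (\<lambda>\<omega>. f (letter_prob M (X 1) (X 1 \<omega>))) = expectation (\<lambda>\<omega>. f (p (idx 1 \<omega>)))"
    for f :: "real \<Rightarrow> real"
    by (intro Bochner_Integration.integral_cong) (auto simp: letter_prob_X)
  have var: "\<sigma>\<^sup>2 = variance (\<lambda>\<omega>. ln (p (idx 1 \<omega>)))"
    unfolding assms(16) expectation[of ln] by (rule expectation[of "\<lambda>x. (ln x - expectation (\<lambda>\<omega>. ln (p (idx 1 \<omega>))))\<^sup>2"])
  obtain C where C: "C > 0" and bound: "\<And>n x. n \<ge> 1 \<Longrightarrow>
      \<bar>prob {\<omega> \<in> space M. sqrt n * (miller_madow a X n \<omega> - shannon_entropy p) / \<sigma> < x}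
       - cdf std_normal_distribution x\<bar> \<le> C * real n powr (- \<delta> / 2)"
    by (rule miller_madow_berry_esseen[OF assms(8,9) moment assms(11-14) var assms(17)]) (assumption | rule that)+
  \<comment> \<open>The bound is uniform in \<open>x\<close>, so it bounds the supremum;
    \<open>cSUP_least\<close> needs only a nonempty range.\<close>
  show ?thesis
    using C bound assms(15) by (intro exI[of _ C] conjI allI impI cSUP_least) auto
qed

end
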